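(* Let $f(x)=\mathbb{E}_{z\sim\mathcal{P}}[f(x,z)]$ satisfy the assumptions in the context (with constants $\mu,L,\hat L>0$, $N\in\mathbb{N}$ and $f^*:=\min f>0$). Fix $\gamma>0$, $T,m\in\mathbb{N}$ and penalties $0\le\lambda_0\le\dots\le\lambda_T$ (with $\lambda_{-1}:=0$). Then with probability at least $1-(T+2)\exp\left(-\frac{m}{18}\right)$, the point $x_{T+1}=\mathtt{BoostERM}(\gamma,T,m)$ (defined in the context) satisfies $$f(x_{T+1})-f^*\le\left(1+\sum_{i=0}^{T}\frac{\lambda_i}{\mu+\lambda_{i-1}}\right)\gamma f^*.$$
   Context: Setting. $(\Omega,\mathcal{F},\mathcal{P})$ is a probability space, $f\colon\mathbb{R}^d\times\Omega\to\mathbb{R}_+$ is a measurable nonnegative function, and $f(x)=\mathbb{E}_{z\sim\mathcal{P}}[f(x,z)]$ is finite. For an i.i.d. sample $S=(z_1,\dots,z_n)$ from $\mathcal{P}$, $f_S(x)=\frac1n\sum_{i=1}^n f(x,z_i)$. Assumptions: (1a) $f$ is $\mu$-strongly convex, i.e. $f-\frac{\mu}{2}\|\cdot\|^2$ is convex; (1b) whenever $|S|\ge N$, $f_S$ is $\mu$-strongly convex with probability at least $5/6$; (2a) for a.e. $z$, $f(\cdot,z)$ is $\hat L$-smooth (differentiable with $\hat L$-Lipschitz gradient); (2b) $f$ is $L$-smooth (with $L\le\hat L$); (3) $f^*=\min f>0$. $\mathtt{ERM}(n,\lambda,x)$: draw fresh i.i.d. samples $z_1,\dots,z_n\sim\mathcal{P}$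 and return a minimizer of $y\mapsto\frac1n\sum_{i=1}^n f(y,z_i)+\frac\lambda2\|y-x\|^2$ (an arbitrary point if no minimizer exists). $\mathtt{ERM\text{-}R}(n,m,\lambda,x)$: call $\mathtt{ERM}(n,\lambda,x)$ independently $m$ times to get $y_1,\dots,y_m$; for each $i$ let $r_i$ be the smallest $r\ge0$ such that more than $m/2$ indices $k$ satisfy $\|y_k-y_i\|\le r$; return $y_{i^*}$ where $i^*$ minimizes $r_i$. $\mathtt{BoostERM}(\gamma,T,m)$: set $\lambda_{-1}=0$, $x_{-1}=0$, $n_{-1}=\max\{\lceil\frac{432\hat L}{\gamma\mu}\rceil,N\}$. For $j=0,\dots,T$: set $x_j=\mathtt{ERM\text{-}R}(n_{j-1},m,\lambda_{j-1},x_{j-1})$ and $$n_j=\max\left\{432\left\lceil\frac{\hat L+\lambda_j}{\mu+\lambda_j}\left(\frac1\gamma+\sum_{i=0}^{j}\frac{\lambda_i}{\mu+\lambda_{i-1}}\right)\right\rceil,\,N\right\}.$$ Return $x_{T+1}=\mathtt{ERM\text{-}R}\left(\left\lceil\frac{L+\lambda_T}{\mu+\lambda_T}n_T\right\rceil,m,\lambda_T,x_T\right)$. All calls use fresh independent samples. *)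

theory Defs
  imports "HOL-Probability.Probability"
begin

definition strongly_convex :: "real \<Rightarrow> ('a::real_inner \<Rightarrow> real) \<Rightarrow> bool" where
  "strongly_convex \<mu> g \<longleftrightarrow> convex_on UNIV (\<lambda>x. g x - \<mu> / 2 * (norm x)\<^sup>2)"

definition smooth :: "real \<Rightarrow> ('a::real_inner \<Rightarrow> real) \<Rightarrow> bool" where
  "smooth L g \<longleftrightarrow> (\<exists>G. (\<forall>x. GDERIV g x :> G x) \<and> L-lipschitz_on UNIV G)"

definition risk :: "'z measure \<Rightarrow> ('a \<Rightarrow> 'z \<Rightarrow> real) \<Rightarrow> 'a \<Rightarrow> real" where
  "risk M f x = (\<integral>z. f x z \<partial>M)"

definition emp_risk :: "('a \<Rightarrow> 'z \<Rightarrow> real) \<Rightarrow> nat \<Rightarrow> (nat \<Rightarrow> 'z) \<Rightarrow> 'a \<Rightarrow> real" where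
  "emp_risk f n S x = (\<Sum>i<n. f x (S i)) / real n"

abbreviation sample :: "'z measure \<Rightarrow> nat \<Rightarrow> (nat \<Rightarrow> 'z) measure" where
  "sample M n \<equiv> (\<Pi>\<^sub>M i\<in>{..<n}. M)"

definition erm_minimizer ::
    "('a::real_normed_vector \<Rightarrow> 'z \<Rightarrow> real) \<Rightarrow> nat \<Rightarrow> real \<Rightarrow> 'a \<Rightarrow> (nat \<Rightarrow> 'z) \<Rightarrow> 'a \<Rightarrow> bool" where
  "erm_minimizer f n lam x S =
     is_arg_min (\<lambda>y. emp_risk f n S y + lam / 2 * (norm (y - x))\<^sup>2) (\<lambda>y. True)"

text \<open>
  A selector \<open>s\<close> resolves the nondeterminism of one ERM call: given the centre \<open>x\<close> and the sample
  \<open>S\<close> it returns a minimizer if there is one, and its value is unconstrained otherwise.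
  Measurability makes the output a random variable.  The minimizer property is demanded for almost
  every sample only, because \<open>f(\<cdot>,z)\<close> is smooth just for almost every \<open>z\<close> and a measurable choice
  of a minimizer need not exist on the exceptional samples.
\<close>

definition erm_selector ::
    "'z measure \<Rightarrow> ('a::real_normed_vector \<Rightarrow> 'z \<Rightarrow> real) \<Rightarrow> nat \<Rightarrow> real \<Rightarrow>
     ('a \<Rightarrow> (nat \<Rightarrow> 'z) \<Rightarrow> 'a) \<Rightarrow> bool" where
  "erm_selector M f n lam s \<longleftrightarrow>
     (\<lambda>(x, S). s x S) \<in> borel_measurable (borel \<Otimes>\<^sub>M sample M n) \<and>
     (\<forall>x. AE S in sample M n. (\<exists>y. erm_minimizer f n lam x S y) \<longrightarrow> erm_minimizer f n lam x S (s x S))"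

text \<open>
  Randomized procedures are represented by the law of their output, so that fresh independent
  samples become product measures (within one call of ERM-R) and monadic composition (across the
  stages of BoostERM).  A selector receives the sample size, the penalty, the centre and the sample.
\<close>

definition ERM ::
    "'z measure \<Rightarrow> (nat \<Rightarrow> real \<Rightarrow> 'a \<Rightarrow> (nat \<Rightarrow> 'z) \<Rightarrow> 'a) \<Rightarrow> nat \<Rightarrow> real \<Rightarrow> 'a \<Rightarrow>
     'a::real_normed_vector measure" where
  "ERM M s n lam x = distr (sample M n) borel (s n lam x)"

definition majority_radius :: "nat \<Rightarrow> (nat \<Rightarrow> 'a::real_normed_vector) \<Rightarrow> nat \<Rightarrow> real" where
  "majority_radius m y i =
     (LEAST r. 0 \<le> r \<and> real (card {k. k < m \<and> norm (y k - y i) \<le> r}) > real m / 2)"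

text \<open>A rule \<open>p\<close> choosing the index returned by ERM-R; ties may be broken in any measurable way.\<close>

definition index_rule :: "nat \<Rightarrow> ((nat \<Rightarrow> 'a::real_normed_vector) \<Rightarrow> nat) \<Rightarrow> bool" where
  "index_rule m p \<longleftrightarrow>
     p \<in> measurable (\<Pi>\<^sub>M k\<in>{..<m}. borel) (count_space UNIV) \<and>
     (m > 0 \<longrightarrow> (\<forall>y\<in>space (\<Pi>\<^sub>M k\<in>{..<m}. borel). is_arg_min (majority_radius m y) (\<lambda>i. i < m) (p y)))"

text \<open>The selector of the \<open>k\<close>-th call of ERM is \<open>s k\<close>.\<close>

definition ERM_R ::
    "'z measure \<Rightarrow> (nat \<Rightarrow> nat \<Rightarrow> real \<Rightarrow> 'a \<Rightarrow> (nat \<Rightarrow> 'z) \<Rightarrow> 'a) \<Rightarrow> ((nat \<Rightarrow> 'a) \<Rightarrow> nat) \<Rightarrow>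
     nat \<Rightarrow> nat \<Rightarrow> real \<Rightarrow> 'a \<Rightarrow> 'a::real_normed_vector measure" where
  "ERM_R M s p n m lam x =
     distr (\<Pi>\<^sub>M k\<in>{..<m}. ERM M (s k) n lam x) borel (\<lambda>y. y (p y))"

text \<open>\<open>prev_penalty lam i\<close> is \<open>lam (i - 1)\<close>, with the convention that penalty number -1 is 0.\<close>

definition prev_penalty :: "(nat \<Rightarrow> real) \<Rightarrow> nat \<Rightarrow> real" where
  "prev_penalty lam i = (case i of 0 \<Rightarrow> 0 | Suc j \<Rightarrow> lam j)"

text \<open>\<open>init_size\<close> is the sample size with index -1, and \<open>stage_size \<dots> j\<close> the one with index \<open>j\<close>.\<close>

definition init_size :: "real \<Rightarrow> real \<Rightarrow> nat \<Rightarrow> real \<Rightarrow> nat" where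
  "init_size \<mu> Lh N \<gamma> = max (nat \<lceil>432 * Lh / (\<gamma> * \<mu>)\<rceil>) N"

definition stage_size :: "real \<Rightarrow> real \<Rightarrow> nat \<Rightarrow> real \<Rightarrow> (nat \<Rightarrow> real) \<Rightarrow> nat \<Rightarrow> nat" where
  "stage_size \<mu> Lh N \<gamma> lam j =
     max (432 * nat \<lceil>(Lh + lam j) / (\<mu> + lam j) *
                     (1 / \<gamma> + (\<Sum>i\<le>j. lam i / (\<mu> + prev_penalty lam i)))\<rceil>) N"

definition final_size :: "real \<Rightarrow> real \<Rightarrow> real \<Rightarrow> nat \<Rightarrow> real \<Rightarrow> (nat \<Rightarrow> real) \<Rightarrow> nat \<Rightarrow> nat" where
  "final_size \<mu> L Lh N \<gamma> lam T =
     nat \<lceil>(L + lam T) / (\<mu> + lam T) * real (stage_size \<mu> Lh N \<gamma> lam T)\<rceil>"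

text \<open>
  \<open>iterate \<dots> j\<close> is the law of \<open>x\<^sub>j\<close> for \<open>0 \<le> j \<le> T\<close>; the point \<open>x\<^sub>j\<close> is produced by the ERM-R call
  that uses the selectors \<open>s j\<close> and the index rule \<open>p j\<close>.
\<close>

primrec iterate ::
    "'z measure \<Rightarrow> (nat \<Rightarrow> nat \<Rightarrow> nat \<Rightarrow> real \<Rightarrow> 'a \<Rightarrow> (nat \<Rightarrow> 'z) \<Rightarrow> 'a) \<Rightarrow>
     (nat \<Rightarrow> (nat \<Rightarrow> 'a) \<Rightarrow> nat) \<Rightarrow> real \<Rightarrow> real \<Rightarrow> nat \<Rightarrow> (nat \<Rightarrow> real) \<Rightarrow> real \<Rightarrow> nat \<Rightarrow> nat \<Rightarrow>
     'a::real_normed_vector measure" where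
  "iterate M s p \<mu> Lh N lam \<gamma> m 0 = ERM_R M (s 0) (p 0) (init_size \<mu> Lh N \<gamma>) m 0 0"
| "iterate M s p \<mu> Lh N lam \<gamma> m (Suc j) =
     iterate M s p \<mu> Lh N lam \<gamma> m j \<bind>
       ERM_R M (s (Suc j)) (p (Suc j)) (stage_size \<mu> Lh N \<gamma> lam j) m (lam j)"

definition BoostERM ::
    "'z measure \<Rightarrow> (nat \<Rightarrow> nat \<Rightarrow> nat \<Rightarrow> real \<Rightarrow> 'a \<Rightarrow> (nat \<Rightarrow> 'z) \<Rightarrow> 'a) \<Rightarrow>
     (nat \<Rightarrow> (nat \<Rightarrow> 'a) \<Rightarrow> nat) \<Rightarrow> real \<Rightarrow> real \<Rightarrow> real \<Rightarrow> nat \<Rightarrow> (nat \<Rightarrow> real) \<Rightarrow>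
     real \<Rightarrow> nat \<Rightarrow> nat \<Rightarrow> 'a::real_normed_vector measure" where
  "BoostERM M s p \<mu> L Lh N lam \<gamma> T m =
     iterate M s p \<mu> Lh N lam \<gamma> m T \<bind>
       ERM_R M (s (Suc T)) (p (Suc T)) (final_size \<mu> L Lh N \<gamma> lam T) m (lam T)"

end

theory Submission
  imports Defs
begin

text \<open>
  For a nonnegative smooth loss, the squared gradient is bounded by \<open>2 L\<close> times the value.  Hence at
  the minimizer \<open>c\<close> of the regularized risk \<open>F\<close> the gradient of the empirical objective, a mean of
  centred independent terms, has second moment at most \<open>2 L F(c) / n\<close>.  Markov's inequality and
  strong convexity of the empirical objective place the empirical minimizer within squared distance
  \<open>48 L F(c) / (n \<kappa>\<^sup>2)\<close> of \<open>c\<close> with probability \<open>2 / 3\<close>.  The majority vote triples the radius, which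
  turns 48 into 432, and by Hoeffding's inequality reduces the failure probability to \<open>exp (- m / 18)\<close>.

  Along the iteration, the minimum over \<open>y\<close> of \<open>f(y) + \<lambda>\<^sub>j / 2 \<parallel>y - x\<^sub>j\<parallel>\<^sup>2\<close> stays below
  \<open>(1 + \<gamma> \<Sum>i\<le>j. \<lambda>\<^sub>i / (\<mu> + \<lambda>\<^sub>i\<^sub>-\<^sub>1)) f\<^sup>*\<close>: the competitor \<open>y\<close> for the next stage is the exact minimizer of
  the previous one.  This is a property of the current point \<open>x\<^sub>j\<close> alone, so the failure probabilities
  of the stages add up through the composition of kernels.
\<close>

section \<open>Strongly convex and smooth functions\<close>

lemma has_real_derivative_along_line:
  fixes g :: "'a::real_inner \<Rightarrow> real"
  assumes "GDERIV g (x + t *\<^sub>R d) :> G"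
  shows "((\<lambda>t. g (x + t *\<^sub>R d)) has_real_derivative inner d G) (at t)"
proof -
  have "((\<lambda>t. x + t *\<^sub>R d) has_derivative (\<lambda>h. h *\<^sub>R d)) (at t)"
    by (auto intro!: derivative_eq_intros)
  moreover have "(g has_derivative (\<lambda>h. inner h G)) (at (x + t *\<^sub>R d))"
    using assms by (simp add: gderiv_def)
  ultimately have "((\<lambda>t. g (x + t *\<^sub>R d)) has_derivative (\<lambda>h. inner (h *\<^sub>R d) G)) (at t)"
    by (rule has_derivative_compose)
  then show ?thesis
    by (simp add: has_field_derivative_def mult_commute_abs mult.commute)
qed

lemma GDERIV_norm_squared:
  fixes a :: "'a::real_inner"
  shows "GDERIV (\<lambda>y. c / 2 * (norm (y - a))\<^sup>2) x :> c *\<^sub>R (x - a)"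
  unfolding gderiv_def power2_norm_eq_inner
  by (auto intro!: derivative_eq_intros simp: inner_commute algebra_simps)

lemma GDERIV_continuous:
  assumes "\<And>x. GDERIV g x :> G x"
  shows "continuous_on UNIV g"
  using assms unfolding gderiv_def
  by (meson continuous_at_imp_continuous_on has_derivative_continuous)

text \<open>On the line through \<open>x\<close> and \<open>y\<close> this is the one-dimensional
  tangent inequality between the parameters 0 and 1.\<close>

lemma convex_on_tangent:
  fixes g :: "'a::real_inner \<Rightarrow> real"
  assumes "convex_on UNIV g" and "GDERIV g x :> G"
  shows "g x + inner (y - x) G \<le> g y"
proof -
  have "convex_on UNIV (\<lambda>t. g (x + t *\<^sub>R (y - x)))"
  proof (rule convex_onI)
    fix t u v :: real
    assume t: "0 < t" "t < 1"
    have "x + ((1 - t) *\<^sub>R u + t *\<^sub>R v) *\<^sub>R (y - x) =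
        (1 - t) *\<^sub>R (x + u *\<^sub>R (y - x)) + t *\<^sub>R (x + v *\<^sub>R (y - x))"
      by (simp add: algebra_simps)
    then show "g (x + ((1 - t) *\<^sub>R u + t *\<^sub>R v) *\<^sub>R (y - x)) \<le>
        (1 - t) * g (x + u *\<^sub>R (y - x)) + t * g (x + v *\<^sub>R (y - x))"
      using convex_onD[OF assms(1), of t] t by simp
  qed auto
  moreover have "((\<lambda>t. g (x + t *\<^sub>R (y - x))) has_real_derivative inner (y - x) G) (at 0)"
    by (rule has_real_derivative_along_line) (use assms in simp)
  ultimately have "g (x + 1 *\<^sub>R (y - x)) - g (x + 0 *\<^sub>R (y - x)) \<ge> inner (y - x) G * (1 - 0)"
    by (intro convex_on_imp_above_tangent[where A = UNIV]) auto
  then show ?thesis by simp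
qed

text \<open>Apply the tangent inequality to \<open>g\<close> minus its quadratic part; the two
  squared norms and the linear correction recombine into the square of
  \<open>norm (y - x)\<close>.\<close>

lemma strongly_convex_tangent:
  fixes g :: "'a::real_inner \<Rightarrow> real"
  assumes "strongly_convex \<kappa> g" and "GDERIV g x :> G"
  shows "g x + inner (y - x) G + \<kappa> / 2 * (norm (y - x))\<^sup>2 \<le> g y"
proof -
  have "GDERIV (\<lambda>x. g x - \<kappa> / 2 * (norm (x - 0))\<^sup>2) x :> G - \<kappa> *\<^sub>R (x - 0)"
    by (intro GDERIV_diff assms GDERIV_norm_squared)
  from convex_on_tangent[OF _ this, of y] assms(1)
  have "g x - \<kappa> / 2 * (norm x)\<^sup>2 + inner (y - x) (G - \<kappa> *\<^sub>R x) \<le> g y - \<kappa> / 2 * (norm y)\<^sup>2"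
    by (simp add: strongly_convex_def)
  then show ?thesis
    by (simp add: power2_norm_eq_inner inner_diff inner_commute field_simps)
qed

text \<open>Since \<open>g y\<close> does not exceed \<open>g x\<close>, the quadratic growth must
  be paid for by the linear term, which Cauchy-Schwarz bounds. The lemma gives coercivity in the
  existence proof for minimizers, and later locates an empirical minimizer \<open>y\<close> relative
  to a fixed point \<open>x\<close>.\<close>

lemma strongly_convex_sublevel_dist:
  fixes g :: "'a::real_inner \<Rightarrow> real"
  assumes "strongly_convex \<kappa> g" "\<kappa> > 0" "GDERIV g x :> G" "g y \<le> g x"
  shows "norm (y - x) \<le> 2 * norm G / \<kappa>"
proof (cases "y = x")
  case False
  have "\<kappa> / 2 * (norm (y - x))\<^sup>2 \<le> - inner (y - x) G"
    using strongly_convex_tangent[OF assms(1,3), of y] assms(4) by linarith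
  also have "\<dots> \<le> norm (y - x) * norm G"
    using norm_cauchy_schwarz[of "- (y - x)" G] by (simp only: inner_minus_left norm_minus_cancel)
  finally have "norm (y - x) * (\<kappa> / 2 * norm (y - x)) \<le> norm (y - x) * norm G"
    by (simp add: power2_eq_square mult_ac)
  then have "\<kappa> / 2 * norm (y - x) \<le> norm G"
    using False by simp
  then show ?thesis using assms(2) by (simp add: field_simps)
qed (use assms(2) in simp)

text \<open>Points at least as good as 0 lie in a ball around 0, so compactness yields a minimum on
  that ball, which is then global.\<close>

lemma strongly_convex_minimizer_exists:
  fixes g :: "'a::euclidean_space \<Rightarrow> real"
  assumes "strongly_convex \<kappa> g" "\<kappa> > 0" and G: "\<And>x. GDERIV g x :> G x"
  obtains x where "\<And>y. g x \<le> g y"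
proof -
  let ?B = "cball 0 (2 * norm (G 0) / \<kappa>)"
  have "continuous_on ?B g"
    using GDERIV_continuous[OF G] continuous_on_subset by blast
  moreover have "0 \<in> ?B" using assms(2) by simp
  ultimately obtain x where x: "\<And>y. y \<in> ?B \<Longrightarrow> g x \<le> g y"
    using continuous_attains_inf[of ?B g] compact_cball by blast
  show ?thesis
  proof
    fix y
    show "g x \<le> g y"
    proof (cases "y \<in> ?B")
      case False
      then have "g 0 < g y"
        using strongly_convex_sublevel_dist[OF assms(1,2) G, of y 0] by force
      then show ?thesis using x[OF \<open>0 \<in> ?B\<close>] by simp
    qed (rule x)
  qed
qed

text \<open>The auxiliary function \<open>q\<close> is \<open>g\<close> along the segment minus its
  claimed quadratic majorant, up to a constant. The Lipschitz bound makes its derivative nonpositive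
  for \<open>t \<ge> 0\<close>, so \<open>q 1 \<le> q 0\<close>.\<close>

lemma lipschitz_gradient_upper:
  fixes g :: "'a::real_inner \<Rightarrow> real"
  assumes G: "\<And>x. GDERIV g x :> G x" and lip: "L-lipschitz_on UNIV G"
  shows "g y - g x - inner (y - x) (G x) \<le> L / 2 * (norm (y - x))\<^sup>2"
proof -
  define d where "d = y - x"
  define q where "q t = g (x + t *\<^sub>R d) - t * inner d (G x) - L / 2 * t\<^sup>2 * (norm d)\<^sup>2" for t
  have deriv: "(q has_real_derivative
      (inner d (G (x + t *\<^sub>R d)) - inner d (G x) - L * t * (norm d)\<^sup>2)) (at t)" for t
    unfolding q_def
    by (auto intro!: derivative_eq_intros has_real_derivative_along_line G)
  have "inner d (G (x + t *\<^sub>R d)) - inner d (G x) - L * t * (norm d)\<^sup>2 \<le> 0" if "0 \<le> t" for t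
  proof -
    have "inner d (G (x + t *\<^sub>R d) - G x) \<le> norm d * norm (G (x + t *\<^sub>R d) - G x)"
      by (rule norm_cauchy_schwarz)
    also have "\<dots> \<le> norm d * (L * norm (t *\<^sub>R d))"
      using lipschitz_onD[OF lip, of "x + t *\<^sub>R d" x]
      by (intro mult_left_mono) (auto simp: dist_norm)
    finally show ?thesis
      using that by (simp add: inner_diff_right power2_eq_square mult_ac)
  qed
  then have "q 1 \<le> q 0"
    using DERIV_nonpos_imp_nonincreasing[of 0 1 q] deriv by fastforce
  then show ?thesis by (simp add: q_def d_def algebra_simps)
qed

text \<open>One gradient step of length \<open>1 / L\<close> lowers \<open>g\<close> by at least the
  squared gradient over \<open>2 * L\<close>, and the value reached is still nonnegative.\<close>

lemma nonneg_smooth_gradient_bound: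
  fixes g :: "'a::real_inner \<Rightarrow> real"
  assumes G: "\<And>x. GDERIV g x :> G x" and lip: "L-lipschitz_on UNIV G"
    and "L > 0" and nonneg: "\<And>x. 0 \<le> g x"
  shows "(norm (G x))\<^sup>2 \<le> 2 * L * g x"
proof -
  define y where "y = x - (1 / L) *\<^sub>R G x"
  have "0 \<le> g x + inner (y - x) (G x) + L / 2 * (norm (y - x))\<^sup>2"
    using lipschitz_gradient_upper[OF G lip, of y x] nonneg[of y] by linarith
  also have "\<dots> = g x - (norm (G x))\<^sup>2 / (2 * L)"
  proof -
    have "inner (y - x) (G x) = - ((norm (G x))\<^sup>2 / L)"
      by (simp add: y_def power2_norm_eq_inner)
    moreover have "(norm (y - x))\<^sup>2 = (norm (G x))\<^sup>2 / L\<^sup>2"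
      by (simp add: y_def power_divide)
    ultimately show ?thesis
      using \<open>L > 0\<close> by (simp add: field_simps power2_eq_square)
  qed
  finally show ?thesis using \<open>L > 0\<close> by (simp add: field_simps)
qed

lemma smooth_add_proximal:
  fixes x :: "'a::real_inner"
  assumes "smooth L g" and "l \<ge> 0"
  shows "smooth (L + l) (\<lambda>y. g y + l / 2 * (norm (y - x))\<^sup>2)"
proof -
  obtain G where G: "\<And>x. GDERIV g x :> G x" and lip: "L-lipschitz_on UNIV G"
    using assms by (auto simp: smooth_def)
  have "(L + l)-lipschitz_on UNIV (\<lambda>y. G y + l *\<^sub>R (y - x))"
    using \<open>l \<ge> 0\<close> by (intro lipschitz_on_add lip) (auto intro!: lipschitz_onI simp: dist_norm simp flip: scaleR_diff_right)
  moreover have "GDERIV (\<lambda>y. g y + l / 2 * (norm (y - x))\<^sup>2) y :> G y + l *\<^sub>R (y - x)" for y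
    by (intro GDERIV_add G GDERIV_norm_squared)
  ultimately show ?thesis unfolding smooth_def by (intro exI[of _ "\<lambda>y. G y + l *\<^sub>R (y - x)"]) simp
qed

text \<open>The penalty and the centred square \<open>l / 2 * (norm y)\<^sup>2\<close> differ by an
  affine function of \<open>y\<close>, which preserves convexity.\<close>

lemma strongly_convex_add_proximal:
  fixes x :: "'a::real_inner"
  assumes "strongly_convex \<kappa> g"
  shows "strongly_convex (\<kappa> + l) (\<lambda>y. g y + l / 2 * (norm (y - x))\<^sup>2)"
proof -
  have "convex_on UNIV (\<lambda>y. l / 2 * (norm x)\<^sup>2 - l * inner x y)"
    by (rule convex_onI) (simp_all add: inner_add_right inner_diff_right field_simps)
  then have "convex_on UNIV (\<lambda>y. (g y - \<kappa> / 2 * (norm y)\<^sup>2) + (l / 2 * (norm x)\<^sup>2 - l * inner x y))"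
    using assms unfolding strongly_convex_def by (intro convex_on_add)
  also have "(\<lambda>y. (g y - \<kappa> / 2 * (norm y)\<^sup>2) + (l / 2 * (norm x)\<^sup>2 - l * inner x y)) =
      (\<lambda>y. g y + l / 2 * (norm (y - x))\<^sup>2 - (\<kappa> + l) / 2 * (norm y)\<^sup>2)"
    by (simp add: fun_eq_iff power2_norm_eq_inner inner_diff inner_commute field_simps)
  finally show ?thesis by (simp add: strongly_convex_def)
qed

text \<open>Compare the quadratic lower and upper bounds at 0 in the direction of a unit vector.
  This will ensure that the final sample is at least as large as the one of stage
  \<open>T\<close>.\<close>

lemma strongly_convex_smooth_le:
  fixes g :: "'a::euclidean_space \<Rightarrow> real"
  assumes "strongly_convex \<kappa> g" "smooth L g"
  shows "\<kappa> \<le> L"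
proof -
  obtain G where G: "\<And>x. GDERIV g x :> G x" and lip: "L-lipschitz_on UNIV G"
    using assms by (auto simp: smooth_def)
  obtain b :: 'a where "norm b = 1" using vector_choose_size[of 1] by auto
  with strongly_convex_tangent[OF assms(1) G, of 0 b] lipschitz_gradient_upper[OF G lip, of b 0]
  show ?thesis by simp
qed

section \<open>Empirical risk minimization\<close>

text \<open>Gradients exist only for almost every \<open>z\<close>, yet expectations of them need a
  function on all of the space that is measurable in \<open>z\<close>. Limits of difference
  quotients along the basis vectors provide one for each fixed \<open>x\<close>; where no limit
  exists, \<open>lim\<close> still returns some value, and the second clause does not concern such
  \<open>z\<close>.\<close>

lemma measurable_gradient_selection:
  fixes g :: "'a::euclidean_space \<Rightarrow> 'z \<Rightarrow> real"
  assumes [measurable]: "\<And>x. g x \<in> borel_measurable M"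
  obtains D where "D \<in> borel_measurable M"
    and "\<And>z G. GDERIV (\<lambda>y. g y z) x :> G \<Longrightarrow> D z = G"
proof
  define D where "D z = (\<Sum>b\<in>Basis.
    lim (\<lambda>k. (g (x + inverse (real (Suc k)) *\<^sub>R b) z - g x z) / inverse (real (Suc k))) *\<^sub>R b)" for z
  show "D \<in> borel_measurable M"
    unfolding D_def by measurable
  fix z G assume G: "GDERIV (\<lambda>y. g y z) x :> G"
  have "lim (\<lambda>k. (g (x + inverse (real (Suc k)) *\<^sub>R b) z - g x z) / inverse (real (Suc k))) = inner b G" for b
  proof (rule limI)
    have "((\<lambda>t. g (x + t *\<^sub>R b) z) has_real_derivative inner b G) (at 0)"
      by (rule has_real_derivative_along_line) (use G in simp)
    then have *: "((\<lambda>h. (g (x + h *\<^sub>R b) z - g x z) / h) \<longlongrightarrow> inner b G) (at 0)"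
      by (simp add: DERIV_def)
    have "filterlim (\<lambda>k. inverse (real (Suc k))) (at 0) sequentially"
      unfolding filterlim_at using LIMSEQ_inverse_real_of_nat by auto
    from filterlim_compose[OF * this]
    show "(\<lambda>k. (g (x + inverse (real (Suc k)) *\<^sub>R b) z - g x z) / inverse (real (Suc k))) \<longlonglongrightarrow> inner b G" .
  qed
  then show "D z = G"
    by (simp add: D_def inner_commute[of _ G] euclidean_representation)
qed

text \<open>Expanding the square leaves \<open>n\<close> diagonal terms. Each off-diagonal term
  factors over the coordinates and contains the mean, which is 0.\<close>

lemma sample_sum_second_moment:
  fixes X :: "'z \<Rightarrow> real"
  assumes "prob_space M" and [simp]: "integrable M X" "integrable M (\<lambda>z. (X z)\<^sup>2)"
    and mean: "(\<integral>z. X z \<partial>M) = 0"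
  shows "integrable (sample M n) (\<lambda>S. (\<Sum>i<n. X (S i))\<^sup>2)" (is ?int)
    and "(\<integral>S. (\<Sum>i<n. X (S i))\<^sup>2 \<partial>sample M n) = n * (\<integral>z. (X z)\<^sup>2 \<partial>M)" (is ?eq)
proof -
  interpret M: prob_space M by fact
  interpret product_prob_space "\<lambda>_. M" "{..<n}" ..
  \<comment> \<open>\<open>X (S i) * X (S j)\<close> as a product over all coordinates \<open>k\<close>, for \<open>i = j\<close> and \<open>i \<noteq> j\<close> alike\<close>
  define u where "u i j k z = (if k = i then X z else 1) * (if k = j then X z else 1)"
    for i j k :: nat and z
  have int_u: "integrable M (u i j k)" for i j k
    using assms(2,3) by (cases "k = i"; cases "k = j") (auto simp: u_def[abs_def] power2_eq_square)
  have prod_u: "(\<Prod>k<n. u i j k (S k)) = X (S i) * X (S j)" if "i < n" "j < n" for i j S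
    using that by (simp add: u_def prod.distrib prod.delta)
  have int: "integrable (sample M n) (\<lambda>S. X (S i) * X (S j))" if "i < n" "j < n" for i j
    using product_integrable_prod[of "{..<n}" "u i j"] int_u by (simp add: prod_u that)
  have eq: "(\<integral>S. X (S i) * X (S j) \<partial>sample M n) = (if i = j then \<integral>z. (X z)\<^sup>2 \<partial>M else 0)"
    if "i < n" "j < n" for i j
  proof -
    have "(\<integral>S. X (S i) * X (S j) \<partial>sample M n) = (\<Prod>k<n. \<integral>z. u i j k z \<partial>M)"
      using product_integral_prod[of "{..<n}" "u i j"] int_u by (simp add: prod_u that)
    also have "\<dots> = (if i = j then \<integral>z. (X z)\<^sup>2 \<partial>M else 0)"
    proof (cases "i = j")
      case True
      have "(\<integral>z. u i i k z \<partial>M) = (if k = i then \<integral>z. (X z)\<^sup>2 \<partial>M else 1)" for k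
        by (simp add: u_def power2_eq_square M.prob_space)
      then show ?thesis using True that by (simp add: prod.delta)
    next
      case False
      then have "(\<integral>z. u i j i z \<partial>M) = 0"
        by (simp add: u_def mean)
      then show ?thesis using False that by (auto intro!: prod_zero)
    qed
    finally show ?thesis .
  qed
  have sq: "(\<Sum>i<n. X (S i))\<^sup>2 = (\<Sum>i<n. \<Sum>j<n. X (S i) * X (S j))" for S
    by (simp add: power2_eq_square sum_product)
  show ?int
    unfolding sq by (intro Bochner_Integration.integrable_sum int) auto
  show ?eq
  proof -
    have "(\<integral>S. (\<Sum>i<n. \<Sum>j<n. X (S i) * X (S j)) \<partial>sample M n) =
        (\<Sum>i<n. \<integral>S. (\<Sum>j<n. X (S i) * X (S j)) \<partial>sample M n)"
      by (intro Bochner_Integration.integral_sum Bochner_Integration.integrable_sum int) auto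
    also have "\<dots> = (\<Sum>i<n. \<Sum>j<n. \<integral>S. X (S i) * X (S j) \<partial>sample M n)"
      by (intro sum.cong refl Bochner_Integration.integral_sum int) auto
    also have "\<dots> = n * (\<integral>z. (X z)\<^sup>2 \<partial>M)"
      by (simp add: eq sum.delta)
    finally show ?thesis unfolding sq .
  qed
qed

text \<open>Sum the scalar identity over the coordinates. The squared norm dominates every squared
  coordinate, and on a probability space square integrability gives integrability of the coordinate
  itself.\<close>

lemma sample_sum_norm_second_moment:
  fixes D :: "'z \<Rightarrow> 'a::euclidean_space"
  assumes "prob_space M" and [measurable]: "D \<in> borel_measurable M"
    and sq_int: "integrable M (\<lambda>z. (norm (D z))\<^sup>2)"
    and mean: "\<And>b. b \<in> Basis \<Longrightarrow> (\<integral>z. inner (D z) b \<partial>M) = 0"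
  shows "integrable (sample M n) (\<lambda>S. (norm (\<Sum>i<n. D (S i)))\<^sup>2)" (is ?int)
    and "(\<integral>S. (norm (\<Sum>i<n. D (S i)))\<^sup>2 \<partial>sample M n) = n * (\<integral>z. (norm (D z))\<^sup>2 \<partial>M)" (is ?eq)
proof -
  interpret prob_space M by fact
  have norm_sq: "(norm v)\<^sup>2 = (\<Sum>b\<in>Basis. (inner v b)\<^sup>2)" for v :: 'a
    by (simp only: power2_norm_eq_inner euclidean_inner[of v v]) (simp add: power2_eq_square)
  have comp_sq: "integrable M (\<lambda>z. (inner (D z) b)\<^sup>2)" if "b \<in> Basis" for b
  proof (rule Bochner_Integration.integrable_bound[OF sq_int])
    show "AE z in M. norm ((inner (D z) b)\<^sup>2) \<le> norm ((norm (D z))\<^sup>2)"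
      using that by (simp add: Basis_le_norm abs_le_square_iff[symmetric])
  qed measurable
  have comp: "integrable M (\<lambda>z. inner (D z) b)" if "b \<in> Basis" for b
    by (rule square_integrable_imp_integrable[OF _ comp_sq[OF that]]) measurable
  note moments = sample_sum_second_moment[OF \<open>prob_space M\<close> comp comp_sq mean]
  show ?int
    unfolding norm_sq inner_sum_left by (intro Bochner_Integration.integrable_sum moments(1))
  show ?eq
    unfolding norm_sq inner_sum_left
    by (simp add: Bochner_Integration.integral_sum moments comp_sq sum_distrib_left)
qed

lemma emp_risk_GDERIV:
  assumes "\<And>i. i < n \<Longrightarrow> GDERIV (\<lambda>x. g x (S i)) x :> G i"
  shows "GDERIV (emp_risk g n S) x :> (1 / real n) *\<^sub>R (\<Sum>i<n. G i)"
proof -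
  have "((\<lambda>x. \<Sum>i<n. g x (S i)) has_derivative (\<lambda>h. \<Sum>i<n. inner h (G i))) (at x)"
    using assms by (intro has_derivative_sum) (simp add: gderiv_def)
  from has_derivative_mult_right[OF this, of "1 / real n"] show ?thesis
    by (simp add: emp_risk_def[abs_def] gderiv_def inner_sum_right)
qed

text \<open>Integrating the quadratic upper bound replaces any exchange of derivative and integral.
  With \<open>c\<close> the mean of the \<open>b\<close>-coordinate, minimality gives
  \<open>0 \<le> t * c + L / 2 * t\<^sup>2\<close>; the step \<open>t = - c / L\<close> minimizes
  the right-hand side and forces \<open>c = 0\<close>.\<close>

lemma mean_gradient_at_minimizer:
  fixes g :: "'a::euclidean_space \<Rightarrow> 'z \<Rightarrow> real"
  assumes "prob_space M" and int: "\<And>x. integrable M (g x)"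
    and D: "integrable M D" and "L > 0"
    and upper: "AE z in M. \<forall>y. g y z - g x z - inner (y - x) (D z) \<le> L / 2 * (norm (y - x))\<^sup>2"
    and min: "\<And>y. risk M g x \<le> risk M g y" and "b \<in> Basis"
  shows "(\<integral>z. inner (D z) b \<partial>M) = 0"
proof -
  interpret prob_space M by fact
  define c where "c = (\<integral>z. inner (D z) b \<partial>M)"
  define t where "t = - c / L"
  have intD: "integrable M (\<lambda>z. inner (D z) b)" using D by simp
  have "(\<integral>z. g (x + t *\<^sub>R b) z - g x z \<partial>M) \<le> (\<integral>z. t * inner (D z) b + L / 2 * t\<^sup>2 \<partial>M)"
  proof (rule integral_mono_AE)
    show "AE z in M. g (x + t *\<^sub>R b) z - g x z \<le> t * inner (D z) b + L / 2 * t\<^sup>2"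
      using upper
    proof eventually_elim
      case (elim z)
      from elim[rule_format, of "x + t *\<^sub>R b"] \<open>b \<in> Basis\<close> show ?case
        by (simp add: inner_commute power_mult_distrib)
    qed
  qed (use int intD in auto)
  also have "\<dots> = t * c + L / 2 * t\<^sup>2"
    using intD by (simp add: c_def prob_space)
  also have "(\<integral>z. g (x + t *\<^sub>R b) z - g x z \<partial>M) = risk M g (x + t *\<^sub>R b) - risk M g x"
    using int by (simp add: risk_def)
  finally have "0 \<le> t * c + L / 2 * t\<^sup>2"
    using min[of "x + t *\<^sub>R b"] by linarith
  also have "\<dots> = - (c\<^sup>2 / (2 * L))"
    using \<open>L > 0\<close> by (simp add: t_def field_simps power2_eq_square)
  finally have "c\<^sup>2 \<le> 0" using \<open>L > 0\<close> by (simp add: field_simps)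
  then show ?thesis by (simp add: c_def)
qed

text \<open>The event \<open>A\<close> does not refer to a chosen minimizer: on it a minimizer
  exists, so ERM never falls back to an arbitrary point, and every minimizer is close to
  \<open>x\<close>. Hence the estimate covers any way of selecting one.\<close>

lemma erm_concentration:
  fixes g :: "'a::euclidean_space \<Rightarrow> 'z \<Rightarrow> real"
  assumes "prob_space M" and int: "\<And>x. integrable M (g x)"
    and nonneg: "\<And>x z. z \<in> space M \<Longrightarrow> 0 \<le> g x z"
    and smooth: "AE z in M. smooth L (\<lambda>x. g x z)"
    and pos: "L > 0" "\<kappa> > 0" "n > 0"
    and E: "E \<in> sets (sample M n)" "measure (sample M n) E \<ge> 5 / 6"
      "\<And>S. S \<in> E \<Longrightarrow> strongly_convex \<kappa> (emp_risk g n S)"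
    and min: "\<And>y. risk M g x \<le> risk M g y" and risk_pos: "risk M g x > 0"
  obtains A where "A \<in> sets (sample M n)" "measure (sample M n) A \<ge> 2 / 3"
    and "\<And>S. S \<in> A \<Longrightarrow> \<exists>y. \<forall>y'. emp_risk g n S y \<le> emp_risk g n S y'"
    and "\<And>S y. S \<in> A \<Longrightarrow> (\<And>y'. emp_risk g n S y \<le> emp_risk g n S y') \<Longrightarrow>
      (norm (y - x))\<^sup>2 \<le> 48 * L * risk M g x / (real n * \<kappa>\<^sup>2)"
proof -
  interpret prob_space M by fact
  interpret sample: prob_space "sample M n"
    by (intro prob_space_PiM) unfold_locales
  define R where "R = risk M g x"
  have [measurable]: "g y \<in> borel_measurable M" for y using int by auto
  obtain D where D_meas[measurable]: "D \<in> borel_measurable M"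
    and D: "\<And>z G. GDERIV (\<lambda>y. g y z) x :> G \<Longrightarrow> D z = G"
    using measurable_gradient_selection[of g M x] by auto
  \<comment> \<open>Links the measurable field \<open>D\<close> to a genuine Lipschitz gradient, so
    that both smoothness bounds can be used with \<open>D z\<close> as the gradient at
    \<open>x\<close>.\<close>
  define good where "good z \<longleftrightarrow> (\<exists>G. (\<forall>y. GDERIV (\<lambda>y. g y z) y :> G y) \<and> G x = D z \<and> L-lipschitz_on UNIV G)" for z
  have good: "AE z in M. good z"
    using smooth
  proof eventually_elim
    case (elim z)
    then obtain G where "\<forall>y. GDERIV (\<lambda>y. g y z) y :> G y" "L-lipschitz_on UNIV G"
      by (auto simp: smooth_def)
    moreover from this have "G x = D z" using D by metis
    ultimately show ?case unfolding good_def by blast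
  qed
  have D_bound: "AE z in M. (norm (D z))\<^sup>2 \<le> 2 * L * g x z"
    using good AE_space
  proof eventually_elim
    case (elim z)
    then obtain G where "\<And>y. GDERIV (\<lambda>y. g y z) y :> G y" "G x = D z" "L-lipschitz_on UNIV G"
      by (auto simp: good_def)
    then show ?case
      using nonneg_smooth_gradient_bound[of "\<lambda>y. g y z" G L x] nonneg[OF \<open>z \<in> space M\<close>] pos by simp
  qed
  have D_sq: "integrable M (\<lambda>z. (norm (D z))\<^sup>2)"
    by (rule Bochner_Integration.integrable_bound[of M "\<lambda>z. 2 * L * g x z"])
      (use int D_bound in \<open>auto elim!: eventually_mono\<close>)
  have "integrable M (\<lambda>z. norm (D z))"
    by (rule square_integrable_imp_integrable[OF _ D_sq]) measurable
  then have D_int: "integrable M D"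
    by (simp add: integrable_norm_iff)
  have D_mean: "(\<integral>z. inner (D z) b \<partial>M) = 0" if "b \<in> Basis" for b
  proof (rule mean_gradient_at_minimizer[OF \<open>prob_space M\<close> int D_int \<open>L > 0\<close> _ min that])
    show "AE z in M. \<forall>y. g y z - g x z - inner (y - x) (D z) \<le> L / 2 * (norm (y - x))\<^sup>2"
      using good
    proof eventually_elim
      case (elim z)
      then obtain G where "\<And>y. GDERIV (\<lambda>y. g y z) y :> G y" "G x = D z" "L-lipschitz_on UNIV G"
        by (auto simp: good_def)
      then show ?case
        using lipschitz_gradient_upper[of "\<lambda>y. g y z" G L _ x] by simp
    qed
  qed
  define Q where "Q S = (norm (\<Sum>i<n. D (S i)))\<^sup>2" for S :: "nat \<Rightarrow> 'z"
  have moment: "integrable (sample M n) Q"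
    "(\<integral>S. Q S \<partial>sample M n) = n * (\<integral>z. (norm (D z))\<^sup>2 \<partial>M)"
    unfolding Q_def[abs_def]
    by (rule sample_sum_norm_second_moment[OF \<open>prob_space M\<close> D_meas D_sq D_mean]; assumption)+
  have "(\<integral>z. (norm (D z))\<^sup>2 \<partial>M) \<le> (\<integral>z. 2 * L * g x z \<partial>M)"
    using int D_sq D_bound by (intro integral_mono_AE) auto
  then have "(\<integral>S. Q S \<partial>sample M n) \<le> n * (2 * L * R)"
    unfolding moment by (intro mult_left_mono) (auto simp: R_def risk_def)
  \<comment> \<open>The threshold is six times the bound \<open>n * (2 * L * R)\<close> on the mean,
    so Markov's inequality leaves probability \<open>1 / 6\<close>.\<close>
  moreover have c: "0 < 12 * L * n * R" using pos risk_pos by (simp add: R_def)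
  ultimately have "(\<integral>S. Q S \<partial>sample M n) / (12 * L * n * R) \<le> 1 / 6"
    by (simp add: field_simps)
  moreover have "AE S in sample M n. 0 \<le> Q S" by (simp add: Q_def)
  ultimately have "measure (sample M n) {S \<in> space (sample M n). Q S \<ge> 12 * L * n * R} \<le> 1 / 6"
    using integral_Markov_inequality_measure[OF moment(1), of "{}" "12 * L * n * R", OF _ _ c]
    by (meson order_trans sets.empty_sets)
  moreover have [measurable]: "Q \<in> borel_measurable (sample M n)"
    using moment(1) by auto
  moreover define B where "B = {S \<in> space (sample M n). Q S < 12 * L * n * R}"
  ultimately have B: "B \<in> sets (sample M n)" "measure (sample M n) B \<ge> 5 / 6"
    using sample.prob_neg[of "\<lambda>S. Q S \<ge> 12 * L * n * R"] by (auto simp: not_le)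
  \<comment> \<open>The exceptional sets of the \<open>n\<close> coordinates are merged into one
    null set \<open>Z\<close>, outside of which the gradient argument runs pointwise.\<close>
  have "AE S in sample M n. \<forall>i\<in>{..<n}. good (S i)"
    by (intro AE_finite_allI AE_PiM_component[where M = "\<lambda>_. M"] good prob_space_axioms) auto
  from AE_E3[OF this] obtain Z where Z: "Z \<in> null_sets (sample M n)"
    and Z_good: "\<And>S i. S \<in> space (sample M n) - Z \<Longrightarrow> i < n \<Longrightarrow> good (S i)"
    by (metis lessThan_iff)
  \<comment> \<open>Two events of probability \<open>5 / 6\<close> meet in probability at least
    \<open>2 / 3\<close>, and removing \<open>Z\<close> costs nothing.\<close>
  define A where "A = (E \<inter> B) - Z"
  show ?thesis
  proof
    show "A \<in> sets (sample M n)"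
      using E(1) B(1) Z by (auto simp: A_def)
    have "measure (sample M n) A = measure (sample M n) (E \<inter> B)"
      unfolding A_def using E(1) B(1) Z by (intro measure_Diff_null_set) auto
    moreover have "measure (sample M n) (E \<union> B) = measure (sample M n) E + measure (sample M n) B - measure (sample M n) (E \<inter> B)"
      using E(1) B(1) by (intro measure_Un3) (auto simp: sample.fmeasurable_eq_sets)
    ultimately show "measure (sample M n) A \<ge> 2 / 3"
      using E(2) B(2) sample.prob_le_1[of "E \<union> B"] by linarith
  next
    fix S assume S: "S \<in> A"
    then have "S \<in> space (sample M n) - Z" using E(1) sets.sets_into_space by (force simp: A_def)
    then have "\<forall>i<n. good (S i)" using Z_good by blast
    then obtain G where G: "\<And>i y. i < n \<Longrightarrow> GDERIV (\<lambda>y. g y (S i)) y :> G i y"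
      and Gx: "\<And>i. i < n \<Longrightarrow> G i x = D (S i)"
      unfolding good_def by metis
    have deriv: "GDERIV (emp_risk g n S) y :> (1 / real n) *\<^sub>R (\<Sum>i<n. G i y)" for y
      by (intro emp_risk_GDERIV G)
    have convex: "strongly_convex \<kappa> (emp_risk g n S)"
      using S E(3) by (auto simp: A_def)
    show "\<exists>y. \<forall>y'. emp_risk g n S y \<le> emp_risk g n S y'"
      using strongly_convex_minimizer_exists[OF convex \<open>\<kappa> > 0\<close> deriv] by metis
    \<comment> \<open>Comparison with \<open>x\<close> puts \<open>y\<close> in the sublevel set of
      \<open>x\<close>. Squaring the factor 2 and inserting the threshold 12 produces the constant
      48.\<close>
    fix y assume "\<And>y'. emp_risk g n S y \<le> emp_risk g n S y'"
    from strongly_convex_sublevel_dist[OF convex \<open>\<kappa> > 0\<close> deriv this[of x]]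
    have "norm (y - x) \<le> 2 / (real n * \<kappa>) * norm (\<Sum>i<n. D (S i))"
      by (simp add: Gx)
    then have "(norm (y - x))\<^sup>2 \<le> (2 / (real n * \<kappa>) * norm (\<Sum>i<n. D (S i)))\<^sup>2"
      by (intro power_mono) auto
    also have "\<dots> = 4 / (real n * \<kappa>)\<^sup>2 * Q S"
      by (simp add: Q_def power_mult_distrib power_divide)
    also have "\<dots> \<le> 4 / (real n * \<kappa>)\<^sup>2 * (12 * L * n * R)"
      using S by (intro mult_left_mono) (auto simp: A_def B_def)
    also have "\<dots> = 48 * L * risk M g x / (real n * \<kappa>\<^sup>2)"
      using pos by (simp add: R_def field_simps power2_eq_square)
    finally show "(norm (y - x))\<^sup>2 \<le> 48 * L * risk M g x / (real n * \<kappa>\<^sup>2)" .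
  qed
qed

section \<open>Majority selection\<close>

text \<open>\<open>LEAST\<close> over the reals needs an attained minimum. The count changes only at
  the finitely many distances from \<open>y i\<close>, so the minimum over admissible radii is the
  minimum over the admissible distances, the set \<open>X\<close>.\<close>

lemma majority_radius:
  fixes y :: "nat \<Rightarrow> 'a::real_normed_vector"
  assumes "m > 0"
  defines "Q \<equiv> \<lambda>i r. 0 \<le> r \<and> real (card {k. k < m \<and> norm (y k - y i) \<le> r}) > real m / 2"
  shows "Q i (majority_radius m y i)" and "Q i r \<Longrightarrow> majority_radius m y i \<le> r"
proof -
  define X where "X = {r \<in> (\<lambda>k. norm (y k - y i)) ` {..<m}. Q i r}"
  have reduce: "\<exists>r'\<in>X. r' \<le> r" if r: "Q i r" for r
  proof -
    let ?K = "{k. k < m \<and> norm (y k - y i) \<le> r}"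
    \<comment> \<open>Shrinking \<open>r\<close> to the largest distance it covers leaves the
      counted indices unchanged.\<close>
    define r' where "r' = Max ((\<lambda>k. norm (y k - y i)) ` ?K)"
    have ne: "?K \<noteq> {}"
    proof
      assume K: "?K = {}"
      from r show False unfolding Q_def K by simp
    qed
    then have "r' \<in> (\<lambda>k. norm (y k - y i)) ` ?K"
      unfolding r'_def by (intro Max_in) auto
    moreover have "norm (y k - y i) \<le> r'" if "k \<in> ?K" for k
      unfolding r'_def by (rule Max_ge) (use that in auto)
    ultimately have "?K = {k. k < m \<and> norm (y k - y i) \<le> r'}" "r' \<le> r" "0 \<le> r'"
      "r' \<in> (\<lambda>k. norm (y k - y i)) ` {..<m}"
      by auto
    then have "r' \<in> X" using r by (auto simp: X_def Q_def)
    then show ?thesis using \<open>r' \<le> r\<close> by blast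
  qed
  \<comment> \<open>At the largest distance all \<open>m\<close> indices are counted, so some radius
    is admissible.\<close>
  define R where "R = Max ((\<lambda>k. norm (y k - y i)) ` {..<m})"
  have le_R: "norm (y k - y i) \<le> R" if "k < m" for k
    unfolding R_def by (rule Max_ge) (use that in auto)
  then have "{k. k < m \<and> norm (y k - y i) \<le> R} = {..<m}" by auto
  moreover have "0 \<le> R" using le_R[OF \<open>m > 0\<close>] norm_ge_zero order_trans by blast
  ultimately have "Q i R" using \<open>m > 0\<close> by (simp add: Q_def)
  then have "X \<noteq> {}" using reduce by blast
  moreover have "finite X" by (simp add: X_def)
  ultimately have Min: "Min X \<in> X" "\<And>r. r \<in> X \<Longrightarrow> Min X \<le> r" by auto
  have "Q i (Min X)" using Min(1) unfolding X_def by blast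
  moreover have "Min X \<le> r" if "Q i r" for r
    using reduce[OF that] Min(2) by (meson order_trans)
  ultimately have "majority_radius m y i = Min X"
    unfolding majority_radius_def Q_def by (intro Least_equality) auto
  with \<open>Q i (Min X)\<close> \<open>\<And>r. Q i r \<Longrightarrow> Min X \<le> r\<close>
  show "Q i (majority_radius m y i)" "Q i r \<Longrightarrow> majority_radius m y i \<le> r"
    by auto
qed

lemma majorities_intersect:
  assumes "real (card {k. k < m \<and> P k}) > real m / 2"
    and "real (card {k. k < m \<and> Q k}) > real m / 2"
  obtains k where "k < m" "P k" "Q k"
proof -
  have "card ({k. k < m \<and> P k} \<union> {k. k < m \<and> Q k}) \<le> card {..<m}"
    by (intro card_mono) auto
  moreover have "card {k. k < m \<and> P k} + card {k. k < m \<and> Q k} =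
      card ({k. k < m \<and> P k} \<union> {k. k < m \<and> Q k}) + card ({k. k < m \<and> P k} \<inter> {k. k < m \<and> Q k})"
    by (intro card_Un_Int) auto
  ultimately have "card ({k. k < m \<and> P k} \<inter> {k. k < m \<and> Q k}) \<noteq> 0"
    using assms unfolding card_lessThan by linarith
  then show thesis using that by (auto simp: card_eq_0_iff)
qed

text \<open>Any point within \<open>\<epsilon>\<close> of \<open>x\<close> has majority radius at
  most \<open>2 * \<epsilon>\<close> by the triangle inequality, hence so does the selected one. Its
  majority meets the majority of points near \<open>x\<close>, and a common point gives
  \<open>2 * \<epsilon> + \<epsilon>\<close>.\<close>

lemma majority_selection_dist:
  fixes y :: "nat \<Rightarrow> 'a::real_normed_vector"
  assumes "m > 0" and best: "is_arg_min (majority_radius m y) (\<lambda>i. i < m) i"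
    and close: "real (card {k. k < m \<and> norm (y k - x) \<le> \<epsilon>}) > real m / 2"
  shows "norm (y i - x) \<le> 3 * \<epsilon>"
proof -
  obtain j where j: "j < m" "norm (y j - x) \<le> \<epsilon>"
    using majorities_intersect[OF close close] by blast
  have "{k. k < m \<and> norm (y k - x) \<le> \<epsilon>} \<subseteq> {k. k < m \<and> norm (y k - y j) \<le> 2 * \<epsilon>}"
  proof safe
    fix k assume "norm (y k - x) \<le> \<epsilon>"
    then show "norm (y k - y j) \<le> 2 * \<epsilon>"
      using j(2) norm_triangle_ineq4[of "y k - x" "y j - x"] by simp
  qed
  then have "card {k. k < m \<and> norm (y k - x) \<le> \<epsilon>} \<le> card {k. k < m \<and> norm (y k - y j) \<le> 2 * \<epsilon>}"
    by (intro card_mono) auto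
  moreover have "0 \<le> \<epsilon>" using j(2) norm_ge_zero order_trans by blast
  ultimately have "majority_radius m y j \<le> 2 * \<epsilon>"
    using close by (intro majority_radius(2)[OF \<open>m > 0\<close>]) auto
  moreover have "majority_radius m y i \<le> majority_radius m y j"
    using best j(1) by (auto simp: is_arg_min_linorder)
  ultimately have radius: "majority_radius m y i \<le> 2 * \<epsilon>" by linarith
  have "real (card {k. k < m \<and> norm (y k - y i) \<le> majority_radius m y i}) > real m / 2"
    using majority_radius(1)[OF \<open>m > 0\<close>, of y i] by simp
  then obtain k where "norm (y k - y i) \<le> majority_radius m y i" "norm (y k - x) \<le> \<epsilon>"
    by (rule majorities_intersect[OF _ close]) blast
  with radius show ?thesis
    using norm_triangle_ineq4[of "y k - x" "y k - y i"] by simp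
qed

section \<open>Independent coordinates and the concentration of the majority count\<close>

lemma PiM_coordinates_indep:
  assumes prob: "\<And>i. i \<in> I \<Longrightarrow> prob_space (P i)" and "I \<noteq> {}"
  shows "prob_space.indep_vars (PiM I P) P (\<lambda>i x. x i) I"
proof -
  interpret prob_space "PiM I P" by (intro prob_space_PiM prob)
  have "distr (PiM I P) (PiM I P) (\<lambda>x. \<lambda>i\<in>I. x i) = distr (PiM I P) (PiM I P) (\<lambda>x. x)"
    by (intro distr_cong) (auto simp: space_PiM)
  moreover have "(\<Pi>\<^sub>M i\<in>I. distr (PiM I P) (P i) (\<lambda>x. x i)) = PiM I P"
    by (intro PiM_cong distr_PiM_component prob) auto
  ultimately show ?thesis
    using \<open>I \<noteq> {}\<close> by (subst indep_vars_iff_distr_eq_PiM') auto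
qed

text \<open>Functions of separate coordinates stay independent, and independence says that the joint
  law is the product of the marginals. It serves to express the product of the ERM laws as an image
  of one fixed space of samples.\<close>

lemma PiM_distr:
  assumes prob: "\<And>i. i \<in> I \<Longrightarrow> prob_space (P i)" and "I \<noteq> {}"
    and h [measurable]: "\<And>i. i \<in> I \<Longrightarrow> h i \<in> measurable (P i) (N i)"
  shows "PiM I (\<lambda>i. distr (P i) (N i) (h i)) = distr (PiM I P) (PiM I N) (\<lambda>x. \<lambda>i\<in>I. h i (x i))"
proof -
  interpret prob_space "PiM I P" by (intro prob_space_PiM prob)
  have "indep_vars N (\<lambda>i x. h i (x i)) I"
    by (rule indep_vars_compose2[OF PiM_coordinates_indep]) (use assms in auto)
  then have "distr (PiM I P) (PiM I N) (\<lambda>x. \<lambda>i\<in>I. h i (x i)) =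
      (\<Pi>\<^sub>M i\<in>I. distr (PiM I P) (N i) (\<lambda>x. h i (x i)))"
    using \<open>I \<noteq> {}\<close> by (subst (asm) indep_vars_iff_distr_eq_PiM') auto
  also have "\<dots> = (\<Pi>\<^sub>M i\<in>I. distr (P i) (N i) (h i))"
  proof (intro PiM_cong refl)
    fix i assume i: "i \<in> I"
    have "distr (PiM I P) (N i) (\<lambda>x. h i (x i)) = distr (distr (PiM I P) (P i) (\<lambda>x. x i)) (N i) (h i)"
      using i by (subst distr_distr) (auto simp: comp_def)
    also have "distr (PiM I P) (P i) (\<lambda>x. x i) = P i"
      by (intro distr_PiM_component prob i)
    finally show "distr (PiM I P) (N i) (\<lambda>x. h i (x i)) = distr (P i) (N i) (h i)" .
  qed
  finally show ?thesis ..
qed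

text \<open>The expected number of hits is at least \<open>2 * m / 3\<close>, which exceeds
  \<open>m / 2\<close> by \<open>m / 6\<close>. Hoeffding's inequality for variables in the unit
  interval then has exponent \<open>2 * (m / 6)\<^sup>2 / m = m / 18\<close>. The laws
  \<open>P k\<close> may differ, since each ERM call has its own selector.\<close>

lemma majority_probability:
  fixes P :: "nat \<Rightarrow> 'a measure"
  assumes "m > 0" and prob: "\<And>k. prob_space (P k)" and sets: "\<And>k. sets (P k) = sets N"
    and [measurable]: "A \<in> sets N" and A: "\<And>k. k < m \<Longrightarrow> measure (P k) A \<ge> 2 / 3"
  shows "measure (PiM {..<m} P) {y \<in> space (PiM {..<m} P). real (card {k. k < m \<and> y k \<in> A}) > real m / 2}
    \<ge> 1 - exp (- real m / 18)"
proof -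
  let ?P = "PiM {..<m} P"
  interpret P: prob_space ?P by (intro prob_space_PiM prob)
  note [measurable_cong] = sets
  define X where "X k y = (indicator A (y k) :: real)" for k :: nat and y
  have indep: "P.indep_vars (\<lambda>_. borel) X {..<m}"
  proof -
    have "P.indep_vars P (\<lambda>k y. y k) {..<m}"
      using \<open>m > 0\<close> by (intro PiM_coordinates_indep prob) auto
    then have "P.indep_vars (\<lambda>_. borel) (\<lambda>k y. (indicator A :: 'a \<Rightarrow> real) (y k)) {..<m}"
      by (rule P.indep_vars_compose2) measurable
    then show ?thesis by (simp add: X_def[abs_def])
  qed
  define \<mu> where "\<mu> = (\<Sum>k<m. P.expectation (X k))"
  interpret Hoeffding_ineq ?P "{..<m}" X "\<lambda>_. 0" "\<lambda>_. 1" \<mu>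
    by unfold_locales (use indep in \<open>auto simp: \<mu>_def X_def indicator_def\<close>)
  have "P.expectation (X k) = measure (P k) A" if "k < m" for k
  proof -
    have "P.expectation (X k) = (\<integral>z. indicator A z \<partial>distr ?P (P k) (\<lambda>y. y k))"
      unfolding X_def using that by (subst integral_distr) auto
    also have "distr ?P (P k) (\<lambda>y. y k) = P k"
      using that by (intro distr_PiM_component prob) auto
    also have "(\<integral>z. indicator A z \<partial>P k) = measure (P k) A"
      using sets.sets_into_space[of A "P k"] by (simp add: sets Int_absorb2)
    finally show ?thesis .
  qed
  then have "(\<Sum>k<m. 2 / 3) \<le> \<mu>"
    unfolding \<mu>_def using A by (intro sum_mono) auto
  then have \<mu>: "\<mu> - real m / 2 \<ge> real m / 6" by simp
  have card: "real (card {k. k < m \<and> y k \<in> A}) = (\<Sum>k<m. X k y)" for y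
    by (simp add: X_def sum.If_cases indicator_def Int_def)
  have "P.prob {y \<in> space ?P. (\<Sum>k<m. X k y) \<le> real m / 2} \<le> exp (- 2 * (\<mu> - real m / 2)\<^sup>2 / real m)"
    using Hoeffding_ineq_le[of "\<mu> - real m / 2"] \<mu> \<open>m > 0\<close> by simp
  also have "\<dots> \<le> exp (- 2 * (real m / 6)\<^sup>2 / real m)"
    using \<mu> \<open>m > 0\<close> by (simp add: divide_right_mono power_mono)
  also have "- 2 * (real m / 6)\<^sup>2 / real m = - real m / 18"
    using \<open>m > 0\<close> by (simp add: power2_eq_square)
  finally have "P.prob {y \<in> space ?P. (\<Sum>k<m. X k y) \<le> real m / 2} \<le> exp (- real m / 18)" .
  moreover have "P.prob {y \<in> space ?P. \<not> (\<Sum>k<m. X k y) \<le> real m / 2} =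
      1 - P.prob {y \<in> space ?P. (\<Sum>k<m. X k y) \<le> real m / 2}"
    using random_variable by (intro P.prob_neg) simp
  ultimately show ?thesis
    unfolding card by (simp add: not_le)
qed

section \<open>ERM-R as a probability kernel\<close>

text \<open>The values of \<open>p\<close> are countable, so the space splits into countably many
  measurable pieces, on each of which one fixed coordinate is returned.\<close>

lemma index_rule_select_measurable:
  fixes p :: "(nat \<Rightarrow> 'a::{real_normed_vector, second_countable_topology}) \<Rightarrow> nat"
  assumes "index_rule m p"
  shows "(\<lambda>y. y (p y)) \<in> borel_measurable (\<Pi>\<^sub>M k\<in>{..<m}. borel)"
proof -
  have "(\<lambda>y. y i) \<in> borel_measurable (\<Pi>\<^sub>M k\<in>{..<m}. (borel :: 'a measure))" for i :: nat
  proof (cases "i < m")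
    \<comment> \<open>Points of the product space are extensional: coordinates from \<open>m\<close>
      on are the constant \<open>undefined\<close>.\<close>
    case False
    then have "(\<lambda>y. y i) \<in> borel_measurable (\<Pi>\<^sub>M k\<in>{..<m}. (borel :: 'a measure)) \<longleftrightarrow>
        (\<lambda>y. undefined :: 'a) \<in> borel_measurable (\<Pi>\<^sub>M k\<in>{..<m}. (borel :: 'a measure))"
      by (intro measurable_cong) (auto simp: space_PiM PiE_def extensional_def)
    then show ?thesis by simp
  next
    case True
    then show ?thesis by (intro measurable_component_singleton) simp
  qed
  moreover have "p \<in> measurable (\<Pi>\<^sub>M k\<in>{..<m}. borel) (count_space UNIV)"
    using assms by (simp add: index_rule_def)
  ultimately show ?thesis
    by (rule measurable_compose_countable[of "\<lambda>i y. y i" _ _ p])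
qed

lemma erm_selector_measurable:
  assumes "erm_selector M f n l s"
  shows "(\<lambda>(x, S). s x S) \<in> borel_measurable (borel \<Otimes>\<^sub>M sample M n)"
    and "s x \<in> borel_measurable (sample M n)"
proof -
  show *: "(\<lambda>(x, S). s x S) \<in> borel_measurable (borel \<Otimes>\<^sub>M sample M n)"
    using assms by (simp add: erm_selector_def)
  from measurable_compose[OF measurable_Pair1' this, of x] show "s x \<in> borel_measurable (sample M n)"
    by simp
qed

lemma ERM_prob_space:
  assumes "prob_space M" and "erm_selector M f n l (s n l)"
  shows "prob_space (ERM M s n l x)"
  unfolding ERM_def
  by (intro prob_space.prob_space_distr prob_space_PiM assms erm_selector_measurable(2)[OF assms(2)])

text \<open>In the definition the underlying product measure itself varies with the centre
  \<open>x\<close>. Rewritten as the law of a jointly measurable function of \<open>x\<close> and a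
  fixed family of samples, ERM-R is visibly a measurable kernel, as needed for composing
  stages.\<close>

lemma ERM_R_kernel:
  fixes f :: "'a::euclidean_space \<Rightarrow> 'z \<Rightarrow> real"
  assumes "prob_space M" "m > 0" and s: "\<And>k. erm_selector M f n l (s k n l)" and p: "index_rule m p"
  shows "ERM_R M s p n m l \<in> borel \<rightarrow>\<^sub>M prob_algebra borel"
proof -
  interpret prob_space M by fact
  let ?\<Omega> = "\<Pi>\<^sub>M k\<in>{..<m}. sample M n"
  interpret \<Omega>: prob_space ?\<Omega> by (intro prob_space_PiM) unfold_locales
  define Y where "Y x \<omega> = (\<lambda>k\<in>{..<m}. s k n l x (\<omega> k))" for x and \<omega> :: "nat \<Rightarrow> nat \<Rightarrow> 'z"
  note [measurable] = erm_selector_measurable[OF s] index_rule_select_measurable[OF p]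
  have Y: "case_prod Y \<in> borel \<Otimes>\<^sub>M ?\<Omega> \<rightarrow>\<^sub>M (\<Pi>\<^sub>M k\<in>{..<m}. borel)"
    unfolding Y_def case_prod_beta'
  proof (rule measurable_restrict)
    fix k assume "k \<in> {..<m}"
    then have "(\<lambda>x\<omega>. (fst x\<omega>, snd x\<omega> k)) \<in> borel \<Otimes>\<^sub>M ?\<Omega> \<rightarrow>\<^sub>M borel \<Otimes>\<^sub>M sample M n"
      by measurable
    from measurable_compose[OF this erm_selector_measurable(1)[OF s]]
    show "(\<lambda>x\<omega>. s k n l (fst x\<omega>) (snd x\<omega> k)) \<in> borel_measurable (borel \<Otimes>\<^sub>M ?\<Omega>)"
      by simp
  qed
  then have Yx: "Y x \<in> ?\<Omega> \<rightarrow>\<^sub>M (\<Pi>\<^sub>M k\<in>{..<m}. borel)" for x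
    by measurable
  have law: "ERM_R M s p n m l x = distr ?\<Omega> borel (\<lambda>\<omega>. Y x \<omega> (p (Y x \<omega>)))" for x
  proof -
    have "(\<Pi>\<^sub>M k\<in>{..<m}. ERM M (s k) n l x) = distr ?\<Omega> (\<Pi>\<^sub>M k\<in>{..<m}. borel) (Y x)"
      unfolding ERM_def Y_def using \<open>m > 0\<close>
      by (intro PiM_distr prob_space_PiM) (auto intro: prob_space_axioms prob_space_PiM erm_selector_measurable(2)[OF s])
    then show ?thesis
      unfolding ERM_R_def using Yx by (simp add: distr_distr comp_def index_rule_select_measurable[OF p])
  qed
  have "(\<lambda>(x, \<omega>). Y x \<omega> (p (Y x \<omega>))) \<in> borel_measurable (borel \<Otimes>\<^sub>M ?\<Omega>)"
    using measurable_compose[OF Y index_rule_select_measurable[OF p]] by (simp add: case_prod_beta')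
  moreover have "(\<lambda>x. ?\<Omega>) \<in> borel \<rightarrow>\<^sub>M subprob_algebra ?\<Omega>"
    by (intro measurable_const) (simp add: space_subprob_algebra \<Omega>.subprob_space_axioms)
  ultimately have "ERM_R M s p n m l \<in> borel \<rightarrow>\<^sub>M subprob_algebra borel"
    unfolding law[abs_def] by (rule measurable_distr2)
  moreover have "prob_space (ERM_R M s p n m l x)" for x
    unfolding law by (intro \<Omega>.prob_space_distr measurable_compose[OF Yx index_rule_select_measurable[OF p]])
  ultimately show ?thesis by (intro measurable_prob_algebraI)
qed

text \<open>The randomness enters only through the majority event; on that event the bound with
  radius \<open>3 * \<epsilon>\<close> is deterministic.\<close>

lemma ERM_R_concentration:
  fixes f :: "'a::euclidean_space \<Rightarrow> 'z \<Rightarrow> real"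
  assumes "prob_space M" "m > 0" and s: "\<And>k. erm_selector M f n l (s k n l)" and p: "index_rule m p"
    and close: "\<And>k. measure (sample M n) {S \<in> space (sample M n). norm (s k n l x S - c) \<le> \<epsilon>} \<ge> 2 / 3"
  shows "measure (ERM_R M s p n m l x) {y. norm (y - c) \<le> 3 * \<epsilon>} \<ge> 1 - exp (- real m / 18)"
proof -
  let ?P = "\<Pi>\<^sub>M k\<in>{..<m}. ERM M (s k) n l x"
  interpret P: prob_space ?P
    by (intro prob_space_PiM ERM_prob_space[OF \<open>prob_space M\<close>, where f = f] s)
  have sets_P: "sets ?P = sets (\<Pi>\<^sub>M k\<in>{..<m}. borel)"
    by (intro sets_PiM_cong) (auto simp: ERM_def)
  have space_P: "space ?P = space (\<Pi>\<^sub>M k\<in>{..<m}. borel)"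
    using sets_P by (rule sets_eq_imp_space_eq)
  have select: "(\<lambda>y. y (p y)) \<in> ?P \<rightarrow>\<^sub>M borel"
    using index_rule_select_measurable[OF p] by (simp add: measurable_cong_sets[OF sets_P refl])
  have set1: "{y. norm (y - c) \<le> r} \<in> sets borel" for r by measurable
  have "measure (ERM M (s k) n l x) {y. norm (y - c) \<le> \<epsilon>} \<ge> 2 / 3" for k
    using close[of k] erm_selector_measurable(2)[OF s[of k], of x] set1[of \<epsilon>]
    by (simp add: ERM_def measure_distr vimage_def Int_def conj_commute)
  then have "1 - exp (- real m / 18) \<le>
      measure ?P {y \<in> space ?P. real (card {k. k < m \<and> y k \<in> {y. norm (y - c) \<le> \<epsilon>}}) > real m / 2}"
    by (intro majority_probability[where N = borel] \<open>m > 0\<close> ERM_prob_space[OF \<open>prob_space M\<close>, where f = f] s set1)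
      (auto simp: ERM_def)
  also have "\<dots> \<le> measure ?P ((\<lambda>y. y (p y)) -` {y. norm (y - c) \<le> 3 * \<epsilon>} \<inter> space ?P)"
  proof (rule P.finite_measure_mono)
    show "(\<lambda>y. y (p y)) -` {y. norm (y - c) \<le> 3 * \<epsilon>} \<inter> space ?P \<in> sets ?P"
      using select set1 by (rule measurable_sets)
    show "{y \<in> space ?P. real (card {k. k < m \<and> y k \<in> {y. norm (y - c) \<le> \<epsilon>}}) > real m / 2} \<subseteq>
        (\<lambda>y. y (p y)) -` {y. norm (y - c) \<le> 3 * \<epsilon>} \<inter> space ?P"
    proof
      fix y assume "y \<in> {y \<in> space ?P. real (card {k. k < m \<and> y k \<in> {y. norm (y - c) \<le> \<epsilon>}}) > real m / 2}"
      then have y: "y \<in> space ?P" "real (card {k. k < m \<and> norm (y k - c) \<le> \<epsilon>}) > real m / 2"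
        by auto
      then have "is_arg_min (majority_radius m y) (\<lambda>i. i < m) (p y)"
        using p \<open>m > 0\<close> unfolding space_P index_rule_def by blast
      from majority_selection_dist[OF \<open>m > 0\<close> this y(2)]
      show "y \<in> (\<lambda>y. y (p y)) -` {y. norm (y - c) \<le> 3 * \<epsilon>} \<inter> space ?P"
        using y(1) by simp
    qed
  qed
  also have "\<dots> = measure (ERM_R M s p n m l x) {y. norm (y - c) \<le> 3 * \<epsilon>}"
    unfolding ERM_R_def by (intro measure_distr[symmetric] select set1)
  finally show ?thesis .
qed

text \<open>The integrand is at least \<open>1 - b\<close> on \<open>A\<close> and nonnegative
  elsewhere, and \<open>(1 - b) * measure P A\<close> loses at most \<open>b\<close> against
  \<open>measure P A\<close>. This is the union bound in kernel form.\<close>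

lemma measure_bind_ge:
  assumes "P \<in> space (prob_algebra N)" "K \<in> N \<rightarrow>\<^sub>M prob_algebra N'" "A \<in> sets N" "B \<in> sets N'"
    and A: "measure P A \<ge> 1 - a" and B: "\<And>x. x \<in> A \<Longrightarrow> measure (K x) B \<ge> 1 - b" and "b \<ge> 0"
  shows "measure (P \<bind> K) B \<ge> 1 - (a + b)"
proof -
  interpret prob_space P using assms(1) by (simp add: space_prob_algebra)
  have sets_P: "sets P = sets N" using assms(1) by (simp add: space_prob_algebra)
  have "K \<in> N \<rightarrow>\<^sub>M subprob_algebra N'" using assms(2) by (rule measurable_prob_algebraD)
  then have K: "K \<in> P \<rightarrow>\<^sub>M subprob_algebra N'" by (simp add: measurable_cong_sets[OF sets_P refl])
  have A_P: "A \<in> sets P" using assms(3) sets_P by simp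
  have prob_K: "prob_space (K x)" if "x \<in> space P" for x
    using measurable_space[OF assms(2), of x] that sets_eq_imp_space_eq[OF sets_P] by (simp add: space_prob_algebra)
  have "1 - (a + b) \<le> (1 - b) * measure P A"
  proof -
    have "b * measure P A \<le> b" using \<open>b \<ge> 0\<close> mult_left_le by (simp add: mult_left_le)
    then show ?thesis using A by (simp add: algebra_simps)
  qed
  also have "\<dots> = (\<integral>x. (1 - b) * indicator A x \<partial>P)"
    using A_P sets.sets_into_space[OF A_P] by (simp add: Int_absorb2)
  also have "\<dots> \<le> (\<integral>x. measure (K x) B \<partial>P)"
  proof (rule integral_mono)
    show "integrable P (\<lambda>x. (1 - b) * indicator A x)"
      using A_P by (simp add: emeasure_eq_measure)
    show "integrable P (\<lambda>x. measure (K x) B)"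
    proof (rule integrable_const_bound[of _ 1])
      show "AE x in P. norm (measure (K x) B) \<le> 1"
        using prob_K by (auto intro: prob_space.prob_le_1)
      show "(\<lambda>x. measure (K x) B) \<in> borel_measurable P"
        using measurable_compose[OF K measurable_measure_subprob_algebra[OF assms(4)]] .
    qed
    show "(1 - b) * indicator A x \<le> measure (K x) B" for x
      using B[of x] by (auto simp: indicator_def)
  qed
  also have "\<dots> = measure (P \<bind> K) B"
    by (rule measure_bind[symmetric, OF K assms(4)])
  finally show ?thesis .
qed

section \<open>Stages of BoostERM\<close>

text \<open>Because the minimum is attained, this uncountable union of closed sets is a \<open>G\<^sub>\<delta>\<close> set.\<close>

lemma proximal_sublevel_measurable:
  fixes F :: "'a::euclidean_space \<Rightarrow> real"
  assumes "\<And>x. \<exists>y. \<forall>y'. F y + l / 2 * (norm (y - x))\<^sup>2 \<le> F y' + l / 2 * (norm (y' - x))\<^sup>2"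
  shows "{x. \<exists>y. F y + l / 2 * (norm (y - x))\<^sup>2 \<le> c} \<in> sets borel"
proof -
  have "open (\<Union>y. {x. F y + l / 2 * (norm (y - x))\<^sup>2 < c + 1 / real (Suc k)})" for k
    by (intro open_UN ballI open_Collect_less continuous_intros)
  then have "(\<Inter>k. \<Union>y. {x. F y + l / 2 * (norm (y - x))\<^sup>2 < c + 1 / real (Suc k)}) \<in> sets borel"
    by (intro sets.countable_INT'') (auto intro: borel_open)
  also have "(\<Inter>k. \<Union>y. {x. F y + l / 2 * (norm (y - x))\<^sup>2 < c + 1 / real (Suc k)}) =
      {x. \<exists>y. F y + l / 2 * (norm (y - x))\<^sup>2 \<le> c}" (is "?U = ?V")
  proof
    show "?V \<subseteq> ?U"
    proof
      fix x assume "x \<in> ?V"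
      then obtain y where y: "F y + l / 2 * (norm (y - x))\<^sup>2 \<le> c" by blast
      have "F y + l / 2 * (norm (y - x))\<^sup>2 < c + 1 / real (Suc k)" for k
        using y by (rule le_less_trans) simp
      then show "x \<in> ?U" by blast
    qed
    show "?U \<subseteq> ?V"
    proof
      fix x assume x: "x \<in> ?U"
      obtain y where y: "\<And>y'. F y + l / 2 * (norm (y - x))\<^sup>2 \<le> F y' + l / 2 * (norm (y' - x))\<^sup>2"
        using assms by blast
      have "F y + l / 2 * (norm (y - x))\<^sup>2 \<le> c + 1 / real (Suc k)" for k
      proof -
        from x obtain y' where "F y' + l / 2 * (norm (y' - x))\<^sup>2 < c + 1 / real (Suc k)" by blast
        with y[of y'] show ?thesis by linarith
      qed
      moreover have "(\<lambda>k. c + 1 / real (Suc k)) \<longlonglongrightarrow> c + 0"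
        using LIMSEQ_inverse_real_of_nat by (intro tendsto_intros) (simp add: inverse_eq_divide)
      ultimately have "F y + l / 2 * (norm (y - x))\<^sup>2 \<le> c"
        using LIMSEQ_le_const[of _ "c + 0" "F y + l / 2 * (norm (y - x))\<^sup>2"] by auto
      then show "x \<in> ?V" by blast
    qed
  qed
  finally show ?thesis .
qed

text \<open>Strong convexity of the empirical risk involves uncountably many inequalities on the
  sample, so its event is measured in the completion of the sample space.\<close>

locale strongly_convex_erm = prob_space M
  for M :: "'z measure" +
  fixes f :: "'a::euclidean_space \<Rightarrow> 'z \<Rightarrow> real" and \<mu> L Lh :: real and N :: nat
  assumes nonneg: "\<And>x z. z \<in> space M \<Longrightarrow> 0 \<le> f x z"
    and f_int: "\<And>x. integrable M (f x)"
    and \<mu>_pos: "\<mu> > 0" and Lh_pos: "Lh > 0"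
    and risk_convex: "strongly_convex \<mu> (risk M f)"
    and emp_risk_convex: "\<And>n. n > 0 \<Longrightarrow> n \<ge> N \<Longrightarrow>
      measure (completion (sample M n))
        {S \<in> space (sample M n). strongly_convex \<mu> (emp_risk f n S)} \<ge> 5 / 6"
    and f_smooth: "AE z in M. smooth Lh (\<lambda>x. f x z)"
    and risk_smooth: "smooth L (risk M f)"
    and risk_pos: "\<And>x. 0 < risk M f x"
begin

abbreviation proximal_risk :: "real \<Rightarrow> 'a \<Rightarrow> 'a \<Rightarrow> real" where
  "proximal_risk l x y \<equiv> risk M f y + l / 2 * (norm (y - x))\<^sup>2"

lemma risk_sublevel_measurable: "{x. risk M f x \<le> a} \<in> sets borel"
proof -
  obtain G where "\<And>x. GDERIV (risk M f) x :> G x"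
    using risk_smooth unfolding smooth_def by blast
  then have "continuous_on UNIV (risk M f)" by (rule GDERIV_continuous)
  then show ?thesis by (intro borel_closed closed_Collect_le continuous_on_const)
qed

lemma proximal_risk_minimizer:
  assumes "l \<ge> 0"
  shows "\<exists>y. \<forall>y'. proximal_risk l x y \<le> proximal_risk l x y'"
proof -
  obtain G where "\<And>y. GDERIV (proximal_risk l x) y :> G y"
    using smooth_add_proximal[OF risk_smooth assms, of x] unfolding smooth_def by blast
  moreover have "0 < \<mu> + l" using \<mu>_pos assms by simp
  ultimately obtain y where "\<And>y'. proximal_risk l x y \<le> proximal_risk l x y'"
    using strongly_convex_minimizer_exists[OF strongly_convex_add_proximal[OF risk_convex, of l x]]
    by blast
  then show ?thesis by blast
qed

lemma proximal_risk_upper: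
  assumes "l \<ge> 0" and min: "\<And>y. proximal_risk l x c \<le> proximal_risk l x y"
  shows "risk M f y \<le> proximal_risk l x c + (L + l) / 2 * (norm (y - c))\<^sup>2"
proof -
  obtain G where G: "\<And>y. GDERIV (proximal_risk l x) y :> G y" and lip: "(L + l)-lipschitz_on UNIV G"
    using smooth_add_proximal[OF risk_smooth assms(1), of x] unfolding smooth_def by blast
  have "G c = 0"
  proof -
    have "(\<lambda>h. inner h (G c)) = (\<lambda>h. 0)"
      using G[of c] min unfolding gderiv_def
      by (intro differential_zero_maxmin[of c UNIV "proximal_risk l x"]) auto
    then have "inner (G c) (G c) = 0" by meson
    then show ?thesis by simp
  qed
  then have "proximal_risk l x y \<le> proximal_risk l x c + (L + l) / 2 * (norm (y - c))\<^sup>2"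
    using lipschitz_gradient_upper[OF G lip, of y c] by simp
  moreover have "0 \<le> l / 2 * (norm (y - x))\<^sup>2" using assms(1) by simp
  ultimately show ?thesis by linarith
qed

text \<open>Absorbing the penalty into the loss, as \<open>g\<close>, adds the same term to the
  population and the empirical risk. It keeps the loss nonnegative and shifts both the smoothness
  and the convexity constant by \<open>l\<close>.\<close>

lemma ERM_concentration:
  assumes "n > 0" "n \<ge> N" "l \<ge> 0" and s: "erm_selector M f n l s"
    and min: "\<And>y. proximal_risk l x c \<le> proximal_risk l x y"
  shows "measure (sample M n) {S \<in> space (sample M n).
      (norm (s x S - c))\<^sup>2 \<le> 48 * (Lh + l) * proximal_risk l x c / (real n * (\<mu> + l)\<^sup>2)} \<ge> 2 / 3"
    (is "measure _ ?C \<ge> _")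
proof -
  interpret sample: prob_space "sample M n"
    by (intro prob_space_PiM) unfold_locales
  define g where "g y z = f y z + l / 2 * (norm (y - x))\<^sup>2" for y z
  have risk_g: "risk M g = proximal_risk l x"
    using f_int by (simp add: fun_eq_iff risk_def g_def prob_space)
  have emp_g: "emp_risk g n S = (\<lambda>y. emp_risk f n S y + l / 2 * (norm (y - x))\<^sup>2)" for S
    using \<open>n > 0\<close> by (simp add: fun_eq_iff emp_risk_def g_def sum.distrib add_divide_distrib)
  let ?E = "{S \<in> space (sample M n). strongly_convex \<mu> (emp_risk f n S)}"
  \<comment> \<open>A set outside the sigma-algebra would have \<open>measure\<close> 0, so the
    bound \<open>5 / 6\<close> yields measurability in the completion. The main part is then a
    subset in the original sigma-algebra with equal measure.\<close>
  have "measure (completion (sample M n)) ?E \<noteq> 0"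
    using emp_risk_convex[OF assms(1,2)] by linarith
  then have E_sets: "?E \<in> sets (completion (sample M n))"
    using measure_notin_sets by blast
  define E where "E = main_part (sample M n) ?E"
  have E: "E \<in> sets (sample M n)" "E \<subseteq> ?E"
    using main_part_null_part_Un[OF E_sets] main_part_sets[OF E_sets] by (auto simp: E_def)
  have E_prob: "measure (sample M n) E \<ge> 5 / 6"
    using emp_risk_convex[OF assms(1,2)] emeasure_completion[OF E_sets] by (simp add: measure_def E_def)
  obtain A where A: "A \<in> sets (sample M n)" "measure (sample M n) A \<ge> 2 / 3"
    and ex: "\<And>S. S \<in> A \<Longrightarrow> \<exists>y. \<forall>y'. emp_risk g n S y \<le> emp_risk g n S y'"
    and dist: "\<And>S y. S \<in> A \<Longrightarrow> (\<And>y'. emp_risk g n S y \<le> emp_risk g n S y') \<Longrightarrow>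
      (norm (y - c))\<^sup>2 \<le> 48 * (Lh + l) * risk M g c / (real n * (\<mu> + l)\<^sup>2)"
  proof (rule erm_concentration[of M g "Lh + l" "\<mu> + l" n E c, rotated -1])
    show "integrable M (g y)" for y using f_int by (simp add: g_def[abs_def])
    show "0 \<le> g y z" if "z \<in> space M" for y z using nonneg[OF that] \<open>l \<ge> 0\<close> by (simp add: g_def)
    show "AE z in M. smooth (Lh + l) (\<lambda>y. g y z)"
      unfolding g_def using f_smooth by eventually_elim (rule smooth_add_proximal[OF _ \<open>l \<ge> 0\<close>])
    show "strongly_convex (\<mu> + l) (emp_risk g n S)" if "S \<in> E" for S
      using that E(2) unfolding emp_g by (intro strongly_convex_add_proximal) auto
    show "risk M g c \<le> risk M g y" for y unfolding risk_g by (rule min)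
    show "5 / 6 \<le> measure (sample M n) E" by (rule E_prob)
    show "0 < risk M g c" using risk_pos[of c] \<open>l \<ge> 0\<close> unfolding risk_g by (simp add: add_pos_nonneg)
  qed (use prob_space_axioms \<mu>_pos Lh_pos assms(1,3) E(1) in auto)
  have minimizer: "erm_minimizer f n l x S y \<longleftrightarrow> (\<forall>y'. emp_risk g n S y \<le> emp_risk g n S y')" for S y
    by (simp add: erm_minimizer_def is_arg_min_linorder emp_g)
  have [measurable]: "s x \<in> borel_measurable (sample M n)"
    using s by (rule erm_selector_measurable(2))
  have "?C \<in> sets (sample M n)" by measurable
  \<comment> \<open>The selector may fail to minimize on a null set depending on \<open>x\<close>,
    hence an almost sure inclusion.\<close>
  moreover have "AE S in sample M n. S \<in> A \<longrightarrow> S \<in> ?C"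
  proof -
    have "AE S in sample M n. (\<exists>y. erm_minimizer f n l x S y) \<longrightarrow> erm_minimizer f n l x S (s x S)"
      using s by (simp add: erm_selector_def)
    then show ?thesis
      using AE_space
    proof eventually_elim
      case (elim S)
      show ?case
      proof
        assume S: "S \<in> A"
        then have "erm_minimizer f n l x S (s x S)"
          using elim(1) ex[OF S] unfolding minimizer by blast
        then show "S \<in> ?C"
          using dist[OF S, of "s x S"] elim(2) unfolding minimizer risk_g by simp
      qed
    qed
  qed
  ultimately have "measure (sample M n) A \<le> measure (sample M n) ?C"
    by (intro sample.finite_measure_mono_AE)
  with A(2) show ?thesis by linarith
qed

text \<open>Common core of all stages. The size condition uses an upper bound \<open>v\<close>
  because the exact proximal minimum depends on the random centre \<open>x\<close>, whereas sample
  sizes are fixed in advance.\<close>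

lemma ERM_R_proximal:
  assumes "n > 0" "n \<ge> N" "l \<ge> 0" "m > 0"
    and s: "\<And>k. erm_selector M f n l (s k n l)" and p: "index_rule m p"
    and v: "proximal_risk l x y0 \<le> v"
    and size: "432 * (Lh + l) * v \<le> real n * (\<mu> + l)\<^sup>2 * \<delta>"
  obtains c where "\<And>y. proximal_risk l x c \<le> proximal_risk l x y" "proximal_risk l x c \<le> v"
    and "measure (ERM_R M s p n m l x) {y. (norm (y - c))\<^sup>2 \<le> \<delta>} \<ge> 1 - exp (- real m / 18)"
proof -
  obtain c where min: "\<And>y. proximal_risk l x c \<le> proximal_risk l x y"
    using proximal_risk_minimizer[OF \<open>l \<ge> 0\<close>] by blast
  with v have cv: "proximal_risk l x c \<le> v" using order_trans by blast
  define \<epsilon> where "\<epsilon> = sqrt (48 * (Lh + l) * proximal_risk l x c / (real n * (\<mu> + l)\<^sup>2))"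
  have radicand: "0 \<le> 48 * (Lh + l) * proximal_risk l x c / (real n * (\<mu> + l)\<^sup>2)"
    using Lh_pos \<open>l \<ge> 0\<close> risk_pos[of c] by (intro divide_nonneg_nonneg mult_nonneg_nonneg add_nonneg_nonneg) auto
  have le_\<epsilon>: "norm d \<le> \<epsilon> \<longleftrightarrow> (norm d)\<^sup>2 \<le> 48 * (Lh + l) * proximal_risk l x c / (real n * (\<mu> + l)\<^sup>2)" for d :: 'a
    using real_sqrt_le_iff[of "(norm d)\<^sup>2"] by (simp add: \<epsilon>_def)
  have "1 - exp (- real m / 18) \<le> measure (ERM_R M s p n m l x) {y. norm (y - c) \<le> 3 * \<epsilon>}"
    using ERM_concentration[OF assms(1-3) _ min, OF s] unfolding le_\<epsilon>[symmetric]
    by (intro ERM_R_concentration[where f = f] prob_space_axioms \<open>m > 0\<close> s p)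
  also have "\<dots> \<le> measure (ERM_R M s p n m l x) {y. (norm (y - c))\<^sup>2 \<le> \<delta>}"
  proof -
    have K: "ERM_R M s p n m l x \<in> space (prob_algebra borel)"
      using measurable_space[OF ERM_R_kernel[where s = s, OF prob_space_axioms \<open>m > 0\<close> s p], of x] by simp
    interpret R: prob_space "ERM_R M s p n m l x" using K by (simp add: space_prob_algebra)
    have "{y. (norm (y - c))\<^sup>2 \<le> \<delta>} \<in> sets borel" by measurable
    moreover have "{y. norm (y - c) \<le> 3 * \<epsilon>} \<subseteq> {y. (norm (y - c))\<^sup>2 \<le> \<delta>}"
    proof safe
      fix y assume "norm (y - c) \<le> 3 * \<epsilon>"
      then have "(norm (y - c))\<^sup>2 \<le> (3 * \<epsilon>)\<^sup>2" by (intro power_mono) auto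
      \<comment> \<open>Tripling the radius multiplies the squared bound by 9, and
        \<open>9 * 48 = 432\<close>.\<close>
      also have "\<dots> = 432 * (Lh + l) * proximal_risk l x c / (real n * (\<mu> + l)\<^sup>2)"
        using radicand by (simp add: \<epsilon>_def power_mult_distrib)
      also have "\<dots> \<le> 432 * (Lh + l) * v / (real n * (\<mu> + l)\<^sup>2)"
        using cv Lh_pos \<open>l \<ge> 0\<close> by (intro divide_right_mono mult_left_mono) auto
      also have "\<dots> \<le> \<delta>"
        using size \<open>n > 0\<close> \<mu>_pos \<open>l \<ge> 0\<close> by (subst pos_divide_le_eq) (auto simp: mult_ac)
      finally show "(norm (y - c))\<^sup>2 \<le> \<delta>" .
    qed
    ultimately show ?thesis
      using K by (intro R.finite_measure_mono) (auto simp: space_prob_algebra)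
  qed
  finally show thesis using that min cv by blast
qed

text \<open>The exact minimizer \<open>c\<close> of the old proximal problem is a competitor in the
  new one: its risk is at most \<open>v\<close>, and its penalty with respect to the nearby output
  is at most \<open>l' / 2 * \<delta>\<close>.\<close>

lemma ERM_R_sublevel:
  assumes "n > 0" "n \<ge> N" "l \<ge> 0" "l' \<ge> 0" "m > 0"
    and s: "\<And>k. erm_selector M f n l (s k n l)" and p: "index_rule m p"
    and x: "x \<in> {x. \<exists>y. proximal_risk l x y \<le> v}"
    and size: "432 * (Lh + l) * v \<le> real n * (\<mu> + l)\<^sup>2 * \<delta>"
    and w: "v + l' / 2 * \<delta> \<le> w"
  shows "measure (ERM_R M s p n m l x) {x. \<exists>y. proximal_risk l' x y \<le> w}
    \<ge> 1 - exp (- real m / 18)"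
proof -
  from x obtain y0 where "proximal_risk l x y0 \<le> v" by blast
  then obtain c where c: "proximal_risk l x c \<le> v"
    and prob: "measure (ERM_R M s p n m l x) {y. (norm (y - c))\<^sup>2 \<le> \<delta>} \<ge> 1 - exp (- real m / 18)"
    using ERM_R_proximal[where s = s, OF assms(1-3,5) s p _ size] by blast
  have K: "ERM_R M s p n m l x \<in> space (prob_algebra borel)"
    using measurable_space[OF ERM_R_kernel[where s = s, OF prob_space_axioms \<open>m > 0\<close> s p], of x] by simp
  interpret R: prob_space "ERM_R M s p n m l x" using K by (simp add: space_prob_algebra)
  have "risk M f c \<le> v"
  proof -
    have "0 \<le> l / 2 * (norm (c - x))\<^sup>2" using \<open>l \<ge> 0\<close> by simp
    with c show ?thesis by linarith
  qed
  have "{y. (norm (y - c))\<^sup>2 \<le> \<delta>} \<subseteq> {x. \<exists>y. proximal_risk l' x y \<le> w}"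
  proof safe
    fix x' assume "(norm (x' - c))\<^sup>2 \<le> \<delta>"
    then have "l' / 2 * (norm (c - x'))\<^sup>2 \<le> l' / 2 * \<delta>"
      using \<open>l' \<ge> 0\<close> by (intro mult_left_mono) (auto simp: norm_minus_commute)
    with \<open>risk M f c \<le> v\<close> w show "\<exists>y. proximal_risk l' x' y \<le> w"
      by (intro exI[of _ c]) linarith
  qed
  moreover have "{x. \<exists>y. proximal_risk l' x y \<le> w} \<in> sets borel"
    by (intro proximal_sublevel_measurable proximal_risk_minimizer \<open>l' \<ge> 0\<close>)
  ultimately have "measure (ERM_R M s p n m l x) {y. (norm (y - c))\<^sup>2 \<le> \<delta>} \<le>
      measure (ERM_R M s p n m l x) {x. \<exists>y. proximal_risk l' x y \<le> w}"
    using K by (intro R.finite_measure_mono) (auto simp: space_prob_algebra)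
  with prob show ?thesis by linarith
qed

text \<open>In the last stage smoothness of the proximal risk at its minimizer converts the squared
  distance of the output into a bound on its risk.\<close>

lemma ERM_R_risk:
  assumes "n > 0" "n \<ge> N" "l \<ge> 0" "L > 0" "m > 0"
    and s: "\<And>k. erm_selector M f n l (s k n l)" and p: "index_rule m p"
    and x: "x \<in> {x. \<exists>y. proximal_risk l x y \<le> v}"
    and size: "432 * (Lh + l) * v \<le> real n * (\<mu> + l)\<^sup>2 * \<delta>"
    and w: "v + (L + l) / 2 * \<delta> \<le> w"
  shows "measure (ERM_R M s p n m l x) {x. risk M f x \<le> w}
    \<ge> 1 - exp (- real m / 18)"
proof -
  from x obtain y0 where "proximal_risk l x y0 \<le> v" by blast
  then obtain c where c: "\<And>y. proximal_risk l x c \<le> proximal_risk l x y" "proximal_risk l x c \<le> v"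
    and prob: "measure (ERM_R M s p n m l x) {y. (norm (y - c))\<^sup>2 \<le> \<delta>} \<ge> 1 - exp (- real m / 18)"
    using ERM_R_proximal[where s = s, OF assms(1-3,5) s p _ size] by metis
  have K: "ERM_R M s p n m l x \<in> space (prob_algebra borel)"
    using measurable_space[OF ERM_R_kernel[where s = s, OF prob_space_axioms \<open>m > 0\<close> s p], of x] by simp
  interpret R: prob_space "ERM_R M s p n m l x" using K by (simp add: space_prob_algebra)
  have "{y. (norm (y - c))\<^sup>2 \<le> \<delta>} \<subseteq> {x. risk M f x \<le> w}"
  proof safe
    fix y assume "(norm (y - c))\<^sup>2 \<le> \<delta>"
    then have "(L + l) / 2 * (norm (y - c))\<^sup>2 \<le> (L + l) / 2 * \<delta>"
      using \<open>L > 0\<close> \<open>l \<ge> 0\<close> by (intro mult_left_mono) auto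
    with proximal_risk_upper[OF \<open>l \<ge> 0\<close> c(1), of y] c(2) w
    show "risk M f y \<le> w" by linarith
  qed
  then have "measure (ERM_R M s p n m l x) {y. (norm (y - c))\<^sup>2 \<le> \<delta>} \<le>
      measure (ERM_R M s p n m l x) {x. risk M f x \<le> w}"
    using K risk_sublevel_measurable by (intro R.finite_measure_mono) (auto simp: space_prob_algebra)
  with prob show ?thesis by linarith
qed

end

theorem theorem4p3:
  fixes M :: "'z measure"
    and f :: "real ^ 'd \<Rightarrow> 'z \<Rightarrow> real"
    and \<mu> L Lh fstar \<gamma> :: real
    and N T m :: nat
    and lam :: "nat \<Rightarrow> real"
    and s :: "nat \<Rightarrow> nat \<Rightarrow> nat \<Rightarrow> real \<Rightarrow> real ^ 'd \<Rightarrow> (nat \<Rightarrow> 'z) \<Rightarrow> real ^ 'd"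
    and p :: "nat \<Rightarrow> (nat \<Rightarrow> real ^ 'd) \<Rightarrow> nat"
  assumes "prob_space M"
    and f_measurable: "(\<lambda>(x, z). f x z) \<in> borel_measurable (borel \<Otimes>\<^sub>M M)"
    and f_nonneg: "\<And>x z. z \<in> space M \<Longrightarrow> 0 \<le> f x z"
    and f_integrable: "\<And>x. integrable M (f x)"
    and constants: "\<mu> > 0" "L > 0" "Lh > 0" "L \<le> Lh"
    and risk_strongly_convex: "strongly_convex \<mu> (risk M f)"
    and emp_risk_strongly_convex: "\<And>n. n > 0 \<Longrightarrow> n \<ge> N \<Longrightarrow>
      measure (completion (sample M n))
        {S \<in> space (sample M n). strongly_convex \<mu> (emp_risk f n S)} \<ge> 5 / 6"
    and f_smooth: "AE z in M. smooth Lh (\<lambda>x. f x z)"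
    and risk_smooth: "smooth L (risk M f)"
    and fstar_min: "fstar \<in> range (risk M f)" "\<And>x. fstar \<le> risk M f x"
    and fstar_pos: "fstar > 0"
    and "\<gamma> > 0"
    and penalties: "0 \<le> lam 0" "\<And>i. i < T \<Longrightarrow> lam i \<le> lam (Suc i)"
    and selectors: "\<And>j k n l. n > 0 \<Longrightarrow> l \<ge> 0 \<Longrightarrow> erm_selector M f n l (s j k n l)"
    and index_rules: "\<And>j. index_rule m (p j)"
  shows "measure (BoostERM M s p \<mu> L Lh N lam \<gamma> T m)
           {x. risk M f x - fstar \<le> (1 + (\<Sum>i\<le>T. lam i / (\<mu> + prev_penalty lam i))) * \<gamma> * fstar}
         \<ge> 1 - (real T + 2) * exp (- real m / 18)"
proof (cases "m = 0")
  \<comment> \<open>Without any ERM call the index rule guarantees nothing, but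
    \<open>exp 0 = 1\<close> makes the claimed probability nonpositive.\<close>
  case True
  have "0 \<le> measure (BoostERM M s p \<mu> L Lh N lam \<gamma> T m)
      {x. risk M f x - fstar \<le> (1 + (\<Sum>i\<le>T. lam i / (\<mu> + prev_penalty lam i))) * \<gamma> * fstar}"
    by (rule measure_nonneg)
  moreover have "1 - (real T + 2) * exp (- real m / 18) \<le> 0" using True by simp
  ultimately show ?thesis by (rule order_trans[rotated])
next
  case False
  then have "m > 0" by simp
  interpret strongly_convex_erm M f \<mu> L Lh N
    by (intro strongly_convex_erm.intro strongly_convex_erm_axioms.intro assms less_le_trans[OF fstar_pos])
  define W where "W j = 1 / \<gamma> + (\<Sum>i\<le>j. lam i / (\<mu> + prev_penalty lam i))" for j
  \<comment> \<open>The bound below is \<open>(1 + \<gamma> \<Sum>i\<le>j. \<dots>) * fstar\<close>, written so that it matches the sample sizes.\<close>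
  define B where "B j = {x. \<exists>y. proximal_risk (lam j) x y \<le> \<gamma> * fstar * W j}" for j
  define e where "e = exp (- real m / 18)"
  have lam_nonneg: "0 \<le> lam j" if "j \<le> T" for j
    using that penalties by (induction j) (auto intro: order_trans)
  have B_sets: "B j \<in> sets borel" if "j \<le> T" for j
    unfolding B_def by (intro proximal_sublevel_measurable proximal_risk_minimizer lam_nonneg that)
  have prev_nonneg: "0 \<le> prev_penalty lam j" if "j \<le> T" for j
    using that lam_nonneg by (auto simp: prev_penalty_def split: nat.split)
  have denom: "0 < \<mu> + lam j" if "j \<le> T" for j
    using lam_nonneg[OF that] constants(1) by simp
  have W_ge: "1 / \<gamma> \<le> W j" if "j \<le> T" for j
    using that lam_nonneg prev_nonneg constants(1) unfolding W_def by (force intro!: sum_nonneg)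
  then have W_pos: "0 < W j" if "j \<le> T" for j
    using that \<open>\<gamma> > 0\<close> by (meson divide_pos_pos less_le_trans zero_less_one)
  define n where "n = stage_size \<mu> Lh N \<gamma> lam"
  \<comment> \<open>With \<open>v = \<gamma> * fstar * W j\<close> and
    \<open>\<delta> = \<gamma> * fstar / (\<mu> + lam j)\<close>, the size condition of a stage is
    the first inequality multiplied by \<open>\<gamma> * fstar\<close>.\<close>
  have stage: "real (n j) * (\<mu> + lam j) \<ge> 432 * (Lh + lam j) * W j" "n j > 0" "n j \<ge> N" if "j \<le> T" for j
  proof -
    define r where "r = (Lh + lam j) / (\<mu> + lam j) * W j"
    have "r > 0"
      unfolding r_def using W_pos[OF that] denom[OF that] lam_nonneg[OF that] constants(3) by simp
    have n: "n j = max (432 * nat \<lceil>r\<rceil>) N"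
      by (simp add: n_def stage_size_def r_def W_def)
    then show "n j > 0" "n j \<ge> N" using \<open>r > 0\<close> by (simp_all add: less_max_iff_disj)
    have "432 * r \<le> real (432 * nat \<lceil>r\<rceil>)" using real_nat_ceiling_ge[of r] by simp
    also have "\<dots> \<le> real (n j)" unfolding n by simp
    finally have "432 * r * (\<mu> + lam j) \<le> real (n j) * (\<mu> + lam j)"
      using denom[OF that] by (intro mult_right_mono) auto
    moreover have "432 * r * (\<mu> + lam j) = 432 * (Lh + lam j) * W j"
      using denom[OF that] by (simp add: r_def)
    ultimately show "real (n j) * (\<mu> + lam j) \<ge> 432 * (Lh + lam j) * W j" by linarith
  qed
  \<comment> \<open>The factor is \<open>j + 1\<close> because the point with index 0 already comes
    from one ERM-R call. Membership in \<open>prob_algebra\<close> is carried along for composing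
    with the next kernel.\<close>
  have iterate: "iterate M s p \<mu> Lh N lam \<gamma> m j \<in> space (prob_algebra borel) \<and>
      measure (iterate M s p \<mu> Lh N lam \<gamma> m j) (B j) \<ge> 1 - (real j + 1) * e" if "j \<le> T" for j
    using that
  proof (induction j)
    case 0
    define n0 where "n0 = init_size \<mu> Lh N \<gamma>"
    have n0: "real n0 * (\<gamma> * \<mu>) \<ge> 432 * Lh" "n0 > 0" "n0 \<ge> N"
    proof -
      have "0 < 432 * Lh / (\<gamma> * \<mu>)" using constants \<open>\<gamma> > 0\<close> by simp
      then show "n0 > 0" "n0 \<ge> N" by (auto simp: n0_def init_size_def less_max_iff_disj)
      have "432 * Lh / (\<gamma> * \<mu>) \<le> real n0"
        using real_nat_ceiling_ge[of "432 * Lh / (\<gamma> * \<mu>)"] unfolding n0_def init_size_def by simp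
      then show "real n0 * (\<gamma> * \<mu>) \<ge> 432 * Lh"
        using constants \<open>\<gamma> > 0\<close> by (simp add: pos_divide_le_eq)
    qed
    have sel: "erm_selector M f n0 0 (s 0 k n0 0)" for k
      using selectors n0(2) by simp
    have "1 - e \<le> measure (ERM_R M (s 0) (p 0) n0 m 0 0) (B 0)"
      unfolding e_def B_def
    proof (rule ERM_R_sublevel[where s = "s 0" and l = 0, OF n0(2,3) _ penalties(1) \<open>m > 0\<close> sel index_rules])
      \<comment> \<open>With zero penalty the proximal risk is the risk itself, so its attained
        minimum serves as \<open>v\<close>.\<close>
      show "0 \<in> {x. \<exists>y. proximal_risk 0 x y \<le> fstar}"
        using fstar_min(1) by auto
      have "432 * Lh * fstar \<le> real n0 * (\<gamma> * \<mu>) * fstar"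
        using n0(1) fstar_pos by (intro mult_right_mono) auto
      then show "432 * (Lh + 0) * fstar \<le> real n0 * (\<mu> + 0)\<^sup>2 * (\<gamma> * fstar / \<mu>)"
        using constants(1) by (simp add: power2_eq_square mult_ac)
      have "fstar + lam 0 / 2 * (\<gamma> * fstar / \<mu>) \<le> fstar + lam 0 * (\<gamma> * fstar / \<mu>)"
        using penalties(1) constants fstar_pos \<open>\<gamma> > 0\<close> by (intro add_left_mono mult_right_mono) auto
      also have "\<dots> = \<gamma> * fstar * W 0"
        using \<open>\<gamma> > 0\<close> by (simp add: W_def prev_penalty_def field_simps)
      finally show "fstar + lam 0 / 2 * (\<gamma> * fstar / \<mu>) \<le> \<gamma> * fstar * W 0" .
    qed simp
    moreover have "ERM_R M (s 0) (p 0) n0 m 0 0 \<in> space (prob_algebra borel)"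
      using measurable_space[OF ERM_R_kernel[where s = "s 0", OF prob_space_axioms \<open>m > 0\<close> sel index_rules], of 0]
      by simp
    ultimately show ?case by (simp add: n0_def)
  next
    case (Suc j)
    then have j: "j \<le> T" by simp
    have sel: "erm_selector M f (n j) (lam j) (s (Suc j) k (n j) (lam j))" for k
      using selectors stage(2)[OF j] lam_nonneg[OF j] by simp
    let ?K = "ERM_R M (s (Suc j)) (p (Suc j)) (n j) m (lam j)"
    \<comment> \<open>This squared radius is what the sample size \<open>n j\<close> buys.
      Multiplied by \<open>lam (Suc j)\<close> it is \<open>\<gamma> * fstar\<close> times the
      summand by which \<open>W (Suc j)\<close> exceeds \<open>W j\<close>; the factor one half in
      the penalty is given away.\<close>
    let ?\<delta> = "\<gamma> * fstar / (\<mu> + lam j)"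
    have "1 - e \<le> measure (?K x) (B (Suc j))" if "x \<in> B j" for x
      using that unfolding e_def B_def
    proof (rule ERM_R_sublevel[where s = "s (Suc j)", OF stage(2,3)[OF j] lam_nonneg[OF j]
          lam_nonneg[OF Suc.prems] \<open>m > 0\<close> sel index_rules])
      have "432 * (Lh + lam j) * W j * (\<gamma> * fstar) \<le> real (n j) * (\<mu> + lam j) * (\<gamma> * fstar)"
        using stage(1)[OF j] \<open>\<gamma> > 0\<close> fstar_pos by (intro mult_right_mono) auto
      then show "432 * (Lh + lam j) * (\<gamma> * fstar * W j) \<le> real (n j) * (\<mu> + lam j)\<^sup>2 * ?\<delta>"
        using denom[OF j] by (simp add: power2_eq_square mult_ac)
      have "\<gamma> * fstar * W j + lam (Suc j) / 2 * ?\<delta> \<le> \<gamma> * fstar * W j + lam (Suc j) * ?\<delta>"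
        using lam_nonneg[OF Suc.prems] denom[OF j] fstar_pos \<open>\<gamma> > 0\<close>
        by (intro add_left_mono mult_right_mono) auto
      also have "\<dots> = \<gamma> * fstar * W (Suc j)"
        by (simp add: W_def prev_penalty_def algebra_simps)
      finally show "\<gamma> * fstar * W j + lam (Suc j) / 2 * ?\<delta> \<le> \<gamma> * fstar * W (Suc j)" .
    qed
    moreover have kernel: "?K \<in> borel \<rightarrow>\<^sub>M prob_algebra borel"
      by (rule ERM_R_kernel[where s = "s (Suc j)", OF prob_space_axioms \<open>m > 0\<close> sel index_rules])
    ultimately have "measure (iterate M s p \<mu> Lh N lam \<gamma> m j \<bind> ?K) (B (Suc j)) \<ge> 1 - ((real j + 1) * e + e)"
      using Suc.IH[OF j] B_sets[OF j] B_sets[OF Suc.prems]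
      by (intro measure_bind_ge[where N = borel and N' = borel and A = "B j"]) (auto simp: e_def)
    moreover have "iterate M s p \<mu> Lh N lam \<gamma> m j \<bind> ?K \<in> space (prob_algebra borel)"
      using prob_space_bind'[OF _ kernel] sets_bind'[OF _ kernel] Suc.IH[OF j]
      unfolding space_prob_algebra by blast
    ultimately show ?case by (simp add: n_def algebra_simps)
  qed

  \<comment> \<open>The final stage\<close>
  define nT where "nT = final_size \<mu> L Lh N \<gamma> lam T"
  define \<rho> where "\<rho> = (L + lam T) / (\<mu> + lam T)"
  \<comment> \<open>Ensures \<open>nT \<ge> n T\<close>, through which \<open>nT\<close> inherits
    positivity and the lower bound \<open>N\<close>.\<close>
  have "1 \<le> \<rho>"
    using strongly_convex_smooth_le[OF risk_convex risk_smooth] denom[of T] by (simp add: \<rho>_def)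
  have "real (n T) \<le> \<rho> * real (n T)" using mult_right_mono[OF \<open>1 \<le> \<rho>\<close>, of "real (n T)"] by simp
  have nT_ge: "\<rho> * real (n T) \<le> real nT"
    using real_nat_ceiling_ge[of "\<rho> * real (n T)"] by (simp add: nT_def final_size_def \<rho>_def n_def)
  with \<open>real (n T) \<le> \<rho> * real (n T)\<close> have "n T \<le> nT" by linarith
  then have nT: "nT > 0" "nT \<ge> N" using stage(2,3)[of T] by auto
  have sel: "erm_selector M f nT (lam T) (s (Suc T) k nT (lam T))" for k
    using selectors nT(1) lam_nonneg by simp
  let ?K = "ERM_R M (s (Suc T)) (p (Suc T)) nT m (lam T)"
  \<comment> \<open>The extra factor \<open>\<rho>\<close> in the sample size replaces
    \<open>\<mu> + lam T\<close> by \<open>L + lam T\<close> in the denominator, so the smoothness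
    cost \<open>(L + lam T) / 2 * ?\<delta>\<close> is only
    \<open>\<gamma> * fstar / 2\<close>.\<close>
  let ?\<delta> = "\<gamma> * fstar / (L + lam T)"
  let ?w = "fstar + (1 + (\<Sum>i\<le>T. lam i / (\<mu> + prev_penalty lam i))) * \<gamma> * fstar"
  have L_lam: "0 < L + lam T" using constants(2) lam_nonneg[of T] by simp
  have "1 - e \<le> measure (?K x) {x. risk M f x \<le> ?w}" if "x \<in> B T" for x
    using that unfolding e_def B_def
  proof (rule ERM_R_risk[where s = "s (Suc T)", OF nT lam_nonneg[OF order_refl] constants(2)
        \<open>m > 0\<close> sel index_rules])
    have "432 * (Lh + lam T) * W T * (\<gamma> * fstar) \<le> real (n T) * (\<mu> + lam T) * (\<gamma> * fstar)"
      using stage(1)[of T] \<open>\<gamma> > 0\<close> fstar_pos by (intro mult_right_mono) auto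
    also have "\<dots> = \<rho> * real (n T) * ((\<mu> + lam T)\<^sup>2 * ?\<delta>)"
    proof -
      have "b / a * r * (a\<^sup>2 * (g / b)) = r * a * g" if "0 < a" "0 < b" for a b r g :: real
        using that by (simp add: power2_eq_square)
      from this[OF denom[OF order_refl] L_lam] show ?thesis unfolding \<rho>_def by simp
    qed
    also have "\<dots> \<le> real nT * ((\<mu> + lam T)\<^sup>2 * ?\<delta>)"
      using nT_ge L_lam \<open>\<gamma> > 0\<close> fstar_pos by (intro mult_right_mono) auto
    finally show "432 * (Lh + lam T) * (\<gamma> * fstar * W T) \<le> real nT * (\<mu> + lam T)\<^sup>2 * ?\<delta>"
      by (simp add: mult_ac)
    have "\<gamma> * fstar * W T = fstar + (\<Sum>i\<le>T. lam i / (\<mu> + prev_penalty lam i)) * \<gamma> * fstar"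
      using \<open>\<gamma> > 0\<close> by (simp add: W_def algebra_simps)
    moreover have "(L + lam T) / 2 * ?\<delta> = \<gamma> * fstar / 2"
    proof -
      have "b / 2 * (g / b) = g / 2" if "0 < b" for b g :: real using that by simp
      from this[OF L_lam] show ?thesis .
    qed
    moreover have "0 \<le> \<gamma> * fstar" using \<open>\<gamma> > 0\<close> fstar_pos by simp
    moreover have "?w = fstar + (\<Sum>i\<le>T. lam i / (\<mu> + prev_penalty lam i)) * \<gamma> * fstar + \<gamma> * fstar"
      by (simp only: distrib_right mult_1)
    ultimately show "\<gamma> * fstar * W T + (L + lam T) / 2 * ?\<delta> \<le> ?w"
      by linarith
  qed
  moreover have "?K \<in> borel \<rightarrow>\<^sub>M prob_algebra borel"
    by (rule ERM_R_kernel[where s = "s (Suc T)", OF prob_space_axioms \<open>m > 0\<close> sel index_rules])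
  \<comment> \<open>The \<open>T + 1\<close> calls up to index \<open>T\<close> and the final one
    together give the factor \<open>T + 2\<close>.\<close>
  ultimately have "measure (iterate M s p \<mu> Lh N lam \<gamma> m T \<bind> ?K) {x. risk M f x \<le> ?w}
      \<ge> 1 - ((real T + 1) * e + e)"
    using iterate[of T] B_sets[of T] risk_sublevel_measurable
    by (intro measure_bind_ge[where N = borel and N' = borel and A = "B T"]) (auto simp: e_def)
  then show ?thesis
    by (simp add: BoostERM_def nT_def e_def algebra_simps)
qed

end
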